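(* Let $(E,\|\cdot\|)$ be a Banach space over $\mathbb{K}$ and let $F(\Omega)$ and $F(\Omega,E)$ be $\varepsilon$-into-compatible. Let $(T^{E},T^{\mathbb{K}})$ be a generator for $(\mathcal{F}\nu,E)$ and a strong, consistent family for $(F,E)$, let $\mathcal{F}\nu(\Omega)$ be a Banach space whose closed unit ball $B_{\mathcal{F}\nu(\Omega)}$ is a compact subset of $F(\Omega)$, and let $U$ be a set of uniqueness for $(T^{\mathbb{K}},\mathcal{F}\nu)$. If $(f_{\iota})_{\iota\in I}\subset\mathcal{F}_{\varepsilon}\nu(\Omega,E)$ is a bounded net in $\mathcal{F}\nu(\Omega,E)$ such that $\lim_{\iota}T^{E}(f_{\iota})(x)$ exists for all $x\in U$, then there is $f\in\mathcal{F}_{\varepsilon}\nu(\Omega,E)$ such that $(f_{\iota})_{\iota\in I}$ converges to $f$ in $F(\Omega,E)$.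
   Context: $\mathbb{K}=\mathbb{R}$ or $\mathbb{C}$. All spaces are non-trivial. An lcHs is a locally convex Hausdorff space over $\mathbb{K}$. For an lcHs $X$, $X'_{\kappa}$ is $X'$ with the topology of uniform convergence on absolutely convex compact subsets of $X$, and $X\varepsilon E:=L_{e}(X'_{\kappa},E)$ carries the topology of uniform convergence on equicontinuous subsets of $X'$. $\delta_x(f):=f(x)$. Setting: $\Omega,\omega$ are non-empty sets, $\nu\colon\omega\to(0,\infty)$. For $Y\in\{\mathbb{K},E\}$ (with norm $\|\cdot\|_Y$), $T^{Y}\colon Y^{\Omega}\supset\operatorname{dom}T^{Y}\to Y^{\omega}$ is linear, $\operatorname{AP}(\Omega,Y)\subset Y^{\Omega}$ is a linear subspace, $F(\Omega,Y)=\operatorname{AP}(\Omega,Y)\cap\operatorname{dom}T^{Y}$ (and $F(\Omega)=F(\Omega,\mathbb{K})$) is equipped with some locally convex Hausdorff topology, with $\delta_x\in F(\Omega)'$ for all $x\in\Omega$, and \[ \mathcal{F}\nu(\Omega,Y)=\{f\in F(\Omega,Y)\;|\;|f|:=\sup_{x\in\omega}\|T^{Y}(f)(x)\|_Y\,\nu(x)<\infty\} \] carries the seminorm $|\cdot|$; $\mathcal{F}\nu(\Omega)=\mathcal{F}\nu(\Omega,\mathbb{K})$. $(T^{E},T^{\mathbb{K}})$ is a generator for $(\mathcal{F}\nu,E)$ if $\mathcal{F}\nu(\Omega)$ and $\mathcal{F}\nu(\Omega,E)$ are Hausdorff and $\delta_x\in\mathcal{F}\nu(\Omega)'$ for all $x\in\Omega$.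 Put $T^{\mathbb{K}}_x:=\delta_x\circ T^{\mathbb{K}}$, $x\in\omega$. $F(\Omega)$ and $F(\Omega,E)$ are $\varepsilon$-into-compatible if $S\colon F(\Omega)\varepsilon E\to F(\Omega,E)$, $u\mapsto[x\mapsto u(\delta_x)]$, is a well-defined topological isomorphism onto its range. $(T^{E},T^{\mathbb{K}})$ is consistent for $(F,E)$ if for all $u\in F(\Omega)\varepsilon E$, $x\in\omega$: $S(u)\in F(\Omega,E)$, $T^{\mathbb{K}}_x\in F(\Omega)'$, $T^{E}(S(u))(x)=u(T^{\mathbb{K}}_x)$; strong if for all $e'\in E'$, $f\in F(\Omega,E)$, $x\in\omega$: $e'\circ f\in F(\Omega)$ and $T^{\mathbb{K}}(e'\circ f)(x)=e'(T^{E}(f)(x))$. $\mathcal{F}_{\varepsilon}\nu(\Omega,E):=S(\{u\in F(\Omega)\varepsilon E\;|\;u(B^{\circ})\text{ is bounded in }E\})$ where $B^{\circ}:=\{y'\in F(\Omega)'\;|\;\forall f\in B_{\mathcal{F}\nu(\Omega)}:\ |y'(f)|\le1\}$; it is a linear subspace of $\mathcal{F}\nu(\Omega,E)$. $U\subset\omega$ is a set of uniqueness for $(T^{\mathbb{K}},\mathcal{F}\nu)$ if $T^{\mathbb{K}}_x\in\mathcal{F}\nu(\Omega)'$ for all $x\in U$ and $f\in\mathcal{F}\nu(\Omega)$, $T^{\mathbb{K}}(f)=0$ on $U$ implies $f=0$. *)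

theory Defs
  imports "HOL-Analysis.Analysis" "HOL-Library.Function_Algebras"
begin

section \<open>Scalars and linear structure\<close>

text \<open>The scalar field is \<open>\<real>\<close> or \<open>\<complex>\<close>: a real normed field that is either the image of \<open>\<real>\<close> or
  isometrically isomorphic to \<open>\<complex>\<close> over \<open>\<real>\<close>.\<close>

class real_or_complex = real_normed_field +
  assumes real_or_complex:
    "(\<forall>z. \<exists>r::real. z = r *\<^sub>R 1) \<or>
     (\<exists>h::'a \<Rightarrow> complex. bij h \<and> (\<forall>x y. h (x + y) = h x + h y) \<and> (\<forall>x y. h (x * y) = h x * h y) \<and>
        (\<forall>r. h (r *\<^sub>R 1) = complex_of_real r) \<and> (\<forall>x. cmod (h x) = norm x))"

instance real :: real_or_complex
  by standard auto

instance complex :: real_or_complex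
  by standard (intro disjI2 exI[of _ "\<lambda>z. z"], simp add: scaleR_conv_of_real bij_id[unfolded id_def])

text \<open>A normed space over \<open>'k\<close>: the type class provides the underlying real normed space, and
  \<open>s\<close> is the scalar multiplication over \<open>'k\<close>.\<close>

definition normed_space_over :: "('k::real_normed_field \<Rightarrow> 'e \<Rightarrow> 'e::real_normed_vector) \<Rightarrow> bool" where
  "normed_space_over s \<longleftrightarrow>
     vector_space s \<and> (\<forall>r x. s (of_real r) x = r *\<^sub>R x) \<and> (\<forall>c x. norm (s c x) = norm c * norm x)"

definition fscale :: "('k \<Rightarrow> 'y \<Rightarrow> 'y) \<Rightarrow> 'k \<Rightarrow> ('a \<Rightarrow> 'y) \<Rightarrow> ('a \<Rightarrow> 'y)" where
  "fscale s c f = (\<lambda>x. s c (f x))"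

definition linear_on ::
  "('k \<Rightarrow> 'x \<Rightarrow> 'x) \<Rightarrow> ('k \<Rightarrow> 'y \<Rightarrow> 'y) \<Rightarrow> 'x::ab_group_add set \<Rightarrow> ('x \<Rightarrow> 'y::ab_group_add) \<Rightarrow> bool" where
  "linear_on s1 s2 A T \<longleftrightarrow>
     (\<forall>x\<in>A. \<forall>y\<in>A. T (x + y) = T x + T y) \<and> (\<forall>c. \<forall>x\<in>A. T (s1 c x) = s2 c (T x))"

definition absolutely_convex ::
  "('k::real_normed_field \<Rightarrow> 'x \<Rightarrow> 'x) \<Rightarrow> 'x::ab_group_add set \<Rightarrow> bool" where
  "absolutely_convex s A \<longleftrightarrow>
     (\<forall>x\<in>A. \<forall>y\<in>A. \<forall>c d. norm c + norm d \<le> 1 \<longrightarrow> s c x + s d y \<in> A)"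

section \<open>Locally convex Hausdorff spaces and their duals\<close>

text \<open>The underlying vector space is \<open>topspace X\<close>, a linear subspace of an ambient type.\<close>

definition lcHs :: "('k::real_normed_field \<Rightarrow> 'x \<Rightarrow> 'x) \<Rightarrow> 'x::ab_group_add topology \<Rightarrow> bool" where
  "lcHs s X \<longleftrightarrow>
     module s \<and> module.subspace s (topspace X) \<and>
     continuous_map (prod_topology X X) X (\<lambda>(x, y). x + y) \<and>
     continuous_map (prod_topology euclidean X) X (\<lambda>(c, x). s c x) \<and>
     Hausdorff_space X \<and>
     (\<forall>V. openin X V \<and> 0 \<in> V \<longrightarrow>
        (\<exists>U. openin X U \<and> 0 \<in> U \<and> U \<subseteq> V \<and>
           (\<forall>x\<in>U. \<forall>y\<in>U. \<forall>t. 0 \<le> t \<and> t \<le> 1 \<longrightarrow> s (of_real (1 - t)) x + s (of_real t) y \<in> U)))"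

text \<open>A map on a subspace \<open>A\<close> of a type is represented by its extension by \<open>0\<close> outside \<open>A\<close>, so that
  equality of maps on \<open>A\<close> is equality in HOL and the linear operations are the pointwise ones.\<close>

definition zero_ext :: "'x set \<Rightarrow> ('x \<Rightarrow> 'y::zero) \<Rightarrow> ('x \<Rightarrow> 'y)" where
  "zero_ext A g = (\<lambda>x. if x \<in> A then g x else 0)"

definition dual :: "('k::real_normed_field \<Rightarrow> 'x \<Rightarrow> 'x) \<Rightarrow> 'x::ab_group_add topology \<Rightarrow> ('x \<Rightarrow> 'k) set" where
  "dual s X =
     {\<phi>. linear_on s times (topspace X) \<phi> \<and> continuous_map X euclidean \<phi> \<and> (\<forall>x. x \<notin> topspace X \<longrightarrow> \<phi> x = 0)}"

definition equicontinuous ::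
  "('k::real_normed_field \<Rightarrow> 'x \<Rightarrow> 'x) \<Rightarrow> 'x::ab_group_add topology \<Rightarrow> ('x \<Rightarrow> 'k) set \<Rightarrow> bool" where
  "equicontinuous s X H \<longleftrightarrow>
     H \<subseteq> dual s X \<and> (\<forall>e>0. \<exists>V. openin X V \<and> 0 \<in> V \<and> (\<forall>\<phi>\<in>H. \<forall>x\<in>V. norm (\<phi> x) \<le> e))"

text \<open>The topology on a set \<open>D\<close> of maps of uniform convergence on the members of \<open>\<S>\<close>.\<close>

definition unif_topology :: "('x \<Rightarrow> 'y::real_normed_vector) set \<Rightarrow> 'x set set \<Rightarrow> ('x \<Rightarrow> 'y) topology" where
  "unif_topology D \<S> = topology (\<lambda>W. W \<subseteq> D \<and>
     (\<forall>f\<in>W. \<exists>\<A> e. finite \<A> \<and> \<A> \<subseteq> \<S> \<and> e > 0 \<and>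
        (\<forall>g\<in>D. (\<forall>A\<in>\<A>. \<forall>x\<in>A. norm (g x - f x) \<le> e) \<longrightarrow> g \<in> W)))"

lemma openin_unif_topology:
  "openin (unif_topology D \<S>) W \<longleftrightarrow> W \<subseteq> D \<and>
     (\<forall>f\<in>W. \<exists>\<A> e. finite \<A> \<and> \<A> \<subseteq> \<S> \<and> e > 0 \<and>
        (\<forall>g\<in>D. (\<forall>A\<in>\<A>. \<forall>x\<in>A. norm (g x - f x) \<le> e) \<longrightarrow> g \<in> W))"
proof -
  define P where "P f W \<A> e \<longleftrightarrow> finite \<A> \<and> \<A> \<subseteq> \<S> \<and> e > 0 \<and>
        (\<forall>g\<in>D. (\<forall>A\<in>\<A>. \<forall>x\<in>A. norm (g x - f x) \<le> e) \<longrightarrow> g \<in> W)" for f W \<A> and e :: real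
  have 1: "P f (V \<inter> W) (\<A> \<union> \<B>) (min d e)" if "P f V \<A> d" "P f W \<B> e" for f V W \<A> \<B> d e
    using that unfolding P_def by (auto simp: ball_Un)
  have 2: "P f (\<Union>\<W>) \<A> e" if "P f W \<A> e" "W \<in> \<W>" for f W \<W> \<A> e
    using that unfolding P_def by blast
  have "istopology (\<lambda>W. W \<subseteq> D \<and> (\<forall>f\<in>W. \<exists>\<A> e. P f W \<A> e))"
    unfolding istopology_def
  proof (intro conjI allI impI)
    show "V \<inter> W \<subseteq> D" "\<forall>f\<in>V \<inter> W. \<exists>\<A> e. P f (V \<inter> W) \<A> e"
      if "V \<subseteq> D \<and> (\<forall>f\<in>V. \<exists>\<A> e. P f V \<A> e)" "W \<subseteq> D \<and> (\<forall>f\<in>W. \<exists>\<A> e. P f W \<A> e)" for V W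
      using that 1 by blast+
    show "\<Union>\<W> \<subseteq> D" "\<forall>f\<in>\<Union>\<W>. \<exists>\<A> e. P f (\<Union>\<W>) \<A> e"
      if W0: "\<forall>W\<in>\<W>. W \<subseteq> D \<and> (\<forall>f\<in>W. \<exists>\<A> e. P f W \<A> e)" for \<W>
    proof -
      show "\<Union>\<W> \<subseteq> D" using that by blast
      show "\<forall>f\<in>\<Union>\<W>. \<exists>\<A> e. P f (\<Union>\<W>) \<A> e"
      proof
        fix f assume "f \<in> \<Union>\<W>"
        then obtain W where W: "W \<in> \<W>" "f \<in> W" by blast
        then obtain \<A> e where "P f W \<A> e" using W0 by blast
        from 2[OF this W(1)] show "\<exists>\<A> e. P f (\<Union>\<W>) \<A> e" by blast
      qed
    qed
  qed
  then show ?thesis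
    unfolding unif_topology_def P_def by simp
qed

lemma topspace_unif_topology [simp]: "topspace (unif_topology D \<S>) = D"
proof
  show "topspace (unif_topology D \<S>) \<subseteq> D"
    unfolding topspace_def openin_unif_topology by blast
  have "openin (unif_topology D \<S>) D"
    unfolding openin_unif_topology by (auto intro!: exI[of _ "{}"] exI[of _ "1::real"])
  then show "D \<subseteq> topspace (unif_topology D \<S>)" by (rule openin_subset)
qed

text \<open>The dual with the topology of uniform convergence on absolutely convex compact sets.\<close>

definition dual_kappa ::
  "('k::real_normed_field \<Rightarrow> 'x \<Rightarrow> 'x) \<Rightarrow> 'x::ab_group_add topology \<Rightarrow> ('x \<Rightarrow> 'k) topology" where
  "dual_kappa s X = unif_topology (dual s X) {C. compactin X C \<and> absolutely_convex s C}"

text \<open>The \<open>\<epsilon>\<close>-product of \<open>X\<close> with a normed space \<open>E\<close>.\<close>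

definition eps_maps ::
  "('k::real_normed_field \<Rightarrow> 'x \<Rightarrow> 'x) \<Rightarrow> 'x::ab_group_add topology \<Rightarrow>
   ('k \<Rightarrow> 'e \<Rightarrow> 'e::real_normed_vector) \<Rightarrow> (('x \<Rightarrow> 'k) \<Rightarrow> 'e) set" where
  "eps_maps s X sE =
     {u. linear_on (fscale times) sE (dual s X) u \<and> continuous_map (dual_kappa s X) euclidean u \<and>
         (\<forall>\<phi>. \<phi> \<notin> dual s X \<longrightarrow> u \<phi> = 0)}"

definition eps_product ::
  "('k::real_normed_field \<Rightarrow> 'x \<Rightarrow> 'x) \<Rightarrow> 'x::ab_group_add topology \<Rightarrow>
   ('k \<Rightarrow> 'e \<Rightarrow> 'e::real_normed_vector) \<Rightarrow> (('x \<Rightarrow> 'k) \<Rightarrow> 'e) topology" where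
  "eps_product s X sE = unif_topology (eps_maps s X sE) {H. equicontinuous s X H}"

section \<open>Seminormed spaces\<close>

definition seminorm_topology :: "'x::ab_group_add set \<Rightarrow> ('x \<Rightarrow> real) \<Rightarrow> 'x topology" where
  "seminorm_topology A p = topology (\<lambda>W. W \<subseteq> A \<and> (\<forall>x\<in>W. \<exists>r>0. \<forall>y\<in>A. p (y - x) < r \<longrightarrow> y \<in> W))"

lemma openin_seminorm_topology:
  "openin (seminorm_topology A p) W \<longleftrightarrow> W \<subseteq> A \<and> (\<forall>x\<in>W. \<exists>r>0. \<forall>y\<in>A. p (y - x) < r \<longrightarrow> y \<in> W)"
proof -
  define P where "P x W r \<longleftrightarrow> 0 < r \<and> (\<forall>y\<in>A. p (y - x) < r \<longrightarrow> y \<in> W)" for x W and r :: real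
  have 1: "P x (V \<inter> W) (min d e)" if "P x V d" "P x W e" for x V W d e
    using that unfolding P_def by auto
  have 2: "P x (\<Union>\<W>) r" if "P x W r" "W \<in> \<W>" for x W \<W> r
    using that unfolding P_def by blast
  have "istopology (\<lambda>W. W \<subseteq> A \<and> (\<forall>x\<in>W. \<exists>r. P x W r))"
    unfolding istopology_def
  proof (intro conjI allI impI)
    show "V \<inter> W \<subseteq> A" "\<forall>x\<in>V \<inter> W. \<exists>r. P x (V \<inter> W) r"
      if "V \<subseteq> A \<and> (\<forall>x\<in>V. \<exists>r. P x V r)" "W \<subseteq> A \<and> (\<forall>x\<in>W. \<exists>r. P x W r)" for V W
      using that 1 by blast+
    show "\<Union>\<W> \<subseteq> A" "\<forall>x\<in>\<Union>\<W>. \<exists>r. P x (\<Union>\<W>) r"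
      if W0: "\<forall>W\<in>\<W>. W \<subseteq> A \<and> (\<forall>x\<in>W. \<exists>r. P x W r)" for \<W>
    proof -
      show "\<Union>\<W> \<subseteq> A" using that by blast
      show "\<forall>x\<in>\<Union>\<W>. \<exists>r. P x (\<Union>\<W>) r"
      proof
        fix x assume "x \<in> \<Union>\<W>"
        then obtain W where W: "W \<in> \<W>" "x \<in> W" by blast
        then obtain r where "P x W r" using W0 by blast
        from 2[OF this W(1)] show "\<exists>r. P x (\<Union>\<W>) r" by blast
      qed
    qed
  qed
  then show ?thesis
    unfolding seminorm_topology_def P_def by simp
qed

lemma topspace_seminorm_topology [simp]: "topspace (seminorm_topology A p) = A"
proof
  show "topspace (seminorm_topology A p) \<subseteq> A"
    unfolding topspace_def openin_seminorm_topology by blast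
  have "openin (seminorm_topology A p) A"
    unfolding openin_seminorm_topology by (auto intro!: exI[of _ "1::real"])
  then show "A \<subseteq> topspace (seminorm_topology A p)" by (rule openin_subset)
qed

definition banach_space_on ::
  "('k::real_normed_field \<Rightarrow> 'x \<Rightarrow> 'x) \<Rightarrow> 'x::ab_group_add set \<Rightarrow> ('x \<Rightarrow> real) \<Rightarrow> bool" where
  "banach_space_on s A p \<longleftrightarrow>
     module s \<and> module.subspace s A \<and>
     (\<forall>x\<in>A. p x = 0 \<longleftrightarrow> x = 0) \<and>
     (\<forall>c. \<forall>x\<in>A. p (s c x) = norm c * p x) \<and>
     (\<forall>x\<in>A. \<forall>y\<in>A. p (x + y) \<le> p x + p y) \<and>
     (\<forall>\<sigma>::nat \<Rightarrow> 'x. range \<sigma> \<subseteq> A \<and> (\<forall>e>0. \<exists>N. \<forall>m\<ge>N. \<forall>n\<ge>N. p (\<sigma> m - \<sigma> n) < e) \<longrightarrow>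
        (\<exists>l\<in>A. (\<lambda>n. p (\<sigma> n - l)) \<longlonglongrightarrow> 0))"

section \<open>Weighted function spaces\<close>

text \<open>Below, \<open>X\<close> and \<open>XE\<close> are the topologies of \<open>F(\<Omega>)\<close> and \<open>F(\<Omega>,E)\<close>, whose elements are
  \<open>topspace X\<close> and \<open>topspace XE\<close>; the sets \<open>\<Omega>\<close> and \<open>\<omega>\<close> are the types \<open>'a\<close> and \<open>'w\<close>.
  The operators \<open>T\<close> are total in HOL, only their values on their domains being relevant.\<close>

definition Fnu ::
  "('w \<Rightarrow> real) \<Rightarrow> (('a \<Rightarrow> 'y) \<Rightarrow> 'w \<Rightarrow> 'y::real_normed_vector) \<Rightarrow> ('a \<Rightarrow> 'y) topology \<Rightarrow> ('a \<Rightarrow> 'y) set" where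
  "Fnu \<nu> T X = {f \<in> topspace X. bdd_above (range (\<lambda>x. norm (T f x) * \<nu> x))}"

definition nu_norm ::
  "('w \<Rightarrow> real) \<Rightarrow> (('a \<Rightarrow> 'y) \<Rightarrow> 'w \<Rightarrow> 'y::real_normed_vector) \<Rightarrow> ('a \<Rightarrow> 'y) \<Rightarrow> real" where
  "nu_norm \<nu> T f = (SUP x. norm (T f x) * \<nu> x)"

definition Fnu_topology ::
  "('w \<Rightarrow> real) \<Rightarrow> (('a \<Rightarrow> 'y) \<Rightarrow> 'w \<Rightarrow> 'y::real_normed_vector) \<Rightarrow> ('a \<Rightarrow> 'y) topology \<Rightarrow> ('a \<Rightarrow> 'y) topology" where
  "Fnu_topology \<nu> T X = seminorm_topology (Fnu \<nu> T X) (nu_norm \<nu> T)"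

definition Fnu_ball ::
  "('w \<Rightarrow> real) \<Rightarrow> (('a \<Rightarrow> 'y) \<Rightarrow> 'w \<Rightarrow> 'y::real_normed_vector) \<Rightarrow> ('a \<Rightarrow> 'y) topology \<Rightarrow> ('a \<Rightarrow> 'y) set" where
  "Fnu_ball \<nu> T X = {f \<in> Fnu \<nu> T X. nu_norm \<nu> T f \<le> 1}"

text \<open>The functionals \<open>\<delta>\<^sub>x\<close> and \<open>T\<^sub>x = \<delta>\<^sub>x \<circ> T\<close> on a space \<open>A\<close> of functions.\<close>

definition delta :: "('a \<Rightarrow> 'k) set \<Rightarrow> 'a \<Rightarrow> ('a \<Rightarrow> 'k::zero) \<Rightarrow> 'k" where
  "delta A x = zero_ext A (\<lambda>f. f x)"

definition T_at :: "(('a \<Rightarrow> 'k) \<Rightarrow> 'w \<Rightarrow> 'k::zero) \<Rightarrow> ('a \<Rightarrow> 'k) set \<Rightarrow> 'w \<Rightarrow> ('a \<Rightarrow> 'k) \<Rightarrow> 'k" where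
  "T_at T A x = zero_ext A (\<lambda>f. T f x)"

definition generator ::
  "('w \<Rightarrow> real) \<Rightarrow> (('a \<Rightarrow> 'k) \<Rightarrow> 'w \<Rightarrow> 'k::real_normed_field) \<Rightarrow> ('a \<Rightarrow> 'k) topology \<Rightarrow>
   (('a \<Rightarrow> 'e) \<Rightarrow> 'w \<Rightarrow> 'e::real_normed_vector) \<Rightarrow> ('a \<Rightarrow> 'e) topology \<Rightarrow> bool" where
  "generator \<nu> T X TE XE \<longleftrightarrow>
     Hausdorff_space (Fnu_topology \<nu> T X) \<and> Hausdorff_space (Fnu_topology \<nu> TE XE) \<and>
     (\<forall>x. delta (Fnu \<nu> T X) x \<in> dual (fscale times) (Fnu_topology \<nu> T X))"

definition S_map ::
  "('a \<Rightarrow> 'k::real_normed_field) topology \<Rightarrow> ((('a \<Rightarrow> 'k) \<Rightarrow> 'k) \<Rightarrow> 'e) \<Rightarrow> 'a \<Rightarrow> 'e" where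
  "S_map X u = (\<lambda>x. u (delta (topspace X) x))"

text \<open>\<open>S\<close> is linear by its definition, so that a topological isomorphism onto the range is the same
  as a topological embedding.\<close>

definition eps_into_compatible ::
  "('a \<Rightarrow> 'k::real_normed_field) topology \<Rightarrow> ('k \<Rightarrow> 'e \<Rightarrow> 'e::real_normed_vector) \<Rightarrow>
   ('a \<Rightarrow> 'e) topology \<Rightarrow> bool" where
  "eps_into_compatible X sE XE \<longleftrightarrow>
     S_map X ` eps_maps (fscale times) X sE \<subseteq> topspace XE \<and>
     embedding_map (eps_product (fscale times) X sE) XE (S_map X)"

definition consistent ::
  "(('a \<Rightarrow> 'k) \<Rightarrow> 'w \<Rightarrow> 'k::real_normed_field) \<Rightarrow> ('a \<Rightarrow> 'k) topology \<Rightarrow>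
   ('k \<Rightarrow> 'e \<Rightarrow> 'e::real_normed_vector) \<Rightarrow> (('a \<Rightarrow> 'e) \<Rightarrow> 'w \<Rightarrow> 'e) \<Rightarrow> ('a \<Rightarrow> 'e) topology \<Rightarrow> bool" where
  "consistent T X sE TE XE \<longleftrightarrow>
     (\<forall>u \<in> eps_maps (fscale times) X sE. \<forall>x.
        S_map X u \<in> topspace XE \<and>
        T_at T (topspace X) x \<in> dual (fscale times) X \<and>
        TE (S_map X u) x = u (T_at T (topspace X) x))"

definition strong ::
  "(('a \<Rightarrow> 'k) \<Rightarrow> 'w \<Rightarrow> 'k::real_normed_field) \<Rightarrow> ('a \<Rightarrow> 'k) topology \<Rightarrow>
   ('k \<Rightarrow> 'e \<Rightarrow> 'e::real_normed_vector) \<Rightarrow> (('a \<Rightarrow> 'e) \<Rightarrow> 'w \<Rightarrow> 'e) \<Rightarrow> ('a \<Rightarrow> 'e) topology \<Rightarrow> bool" where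
  "strong T X sE TE XE \<longleftrightarrow>
     (\<forall>e' \<in> dual sE euclidean. \<forall>f \<in> topspace XE. \<forall>x.
        e' \<circ> f \<in> topspace X \<and> T (e' \<circ> f) x = e' (TE f x))"

definition polar_in_dual ::
  "('k::real_normed_field \<Rightarrow> 'x \<Rightarrow> 'x) \<Rightarrow> 'x::ab_group_add topology \<Rightarrow> 'x set \<Rightarrow> ('x \<Rightarrow> 'k) set" where
  "polar_in_dual s X B = {\<phi> \<in> dual s X. \<forall>f\<in>B. norm (\<phi> f) \<le> 1}"

definition F_eps_nu ::
  "('w \<Rightarrow> real) \<Rightarrow> (('a \<Rightarrow> 'k) \<Rightarrow> 'w \<Rightarrow> 'k::real_normed_field) \<Rightarrow> ('a \<Rightarrow> 'k) topology \<Rightarrow>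
   ('k \<Rightarrow> 'e \<Rightarrow> 'e::real_normed_vector) \<Rightarrow> ('a \<Rightarrow> 'e) set" where
  "F_eps_nu \<nu> T X sE =
     S_map X ` {u \<in> eps_maps (fscale times) X sE.
                  bounded (u ` polar_in_dual (fscale times) X (Fnu_ball \<nu> T X))}"

definition set_of_uniqueness ::
  "('w \<Rightarrow> real) \<Rightarrow> (('a \<Rightarrow> 'k) \<Rightarrow> 'w \<Rightarrow> 'k::real_normed_field) \<Rightarrow> ('a \<Rightarrow> 'k) topology \<Rightarrow> 'w set \<Rightarrow> bool" where
  "set_of_uniqueness \<nu> T X U \<longleftrightarrow>
     (\<forall>x\<in>U. T_at T (Fnu \<nu> T X) x \<in> dual (fscale times) (Fnu_topology \<nu> T X)) \<and>
     (\<forall>f \<in> Fnu \<nu> T X. (\<forall>x\<in>U. T f x = 0) \<longrightarrow> f = 0)"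

section \<open>Nets\<close>

definition directed_on :: "'i set \<Rightarrow> ('i \<Rightarrow> 'i \<Rightarrow> bool) \<Rightarrow> bool" where
  "directed_on I le \<longleftrightarrow>
     I \<noteq> {} \<and> (\<forall>i\<in>I. le i i) \<and> (\<forall>i\<in>I. \<forall>j\<in>I. \<forall>k\<in>I. le i j \<longrightarrow> le j k \<longrightarrow> le i k) \<and>
     (\<forall>i\<in>I. \<forall>j\<in>I. \<exists>k\<in>I. le i k \<and> le j k)"

text \<open>Convergence of a net is convergence along the filter of tails of its index set.\<close>

definition net_filter :: "'i set \<Rightarrow> ('i \<Rightarrow> 'i \<Rightarrow> bool) \<Rightarrow> 'i filter" where
  "net_filter I le = (INF i\<in>I. principal {j \<in> I. le i j})"

lemma eventually_net_filter:
  assumes "directed_on I le"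
  shows "eventually P (net_filter I le) \<longleftrightarrow> (\<exists>i\<in>I. \<forall>j\<in>I. le i j \<longrightarrow> P j)"
proof -
  have "eventually P (net_filter I le) \<longleftrightarrow> (\<exists>i\<in>I. eventually P (principal {j \<in> I. le i j}))"
    unfolding net_filter_def
  proof (rule eventually_INF_base)
    show "I \<noteq> {}" using assms by (simp add: directed_on_def)
    show "\<exists>k\<in>I. principal {l \<in> I. le k l} \<le> inf (principal {l \<in> I. le i l}) (principal {l \<in> I. le j l})"
      if "i \<in> I" "j \<in> I" for i j
    proof -
      obtain k where k: "k \<in> I" "le i k" "le j k"
        using assms \<open>i \<in> I\<close> \<open>j \<in> I\<close> unfolding directed_on_def by blast
      have "le i l \<and> le j l" if "l \<in> I" "le k l" for l
        using assms \<open>i \<in> I\<close> \<open>j \<in> I\<close> k that unfolding directed_on_def by blast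
      then show ?thesis using k(1) by (auto intro!: bexI[of _ k])
    qed
  qed
  then show ?thesis by (auto simp: eventually_principal)
qed

end

theory Submission
  imports Defs
begin

text \<open>
  Write \<open>f\<^sub>\<iota> = S u\<^sub>\<iota>\<close>, \<open>B\<close> for the compact unit ball of \<open>\<F>\<nu>(\<Omega>)\<close> and \<open>p(y) = sup\<^sub>B |y|\<close> on \<open>F(\<Omega>)'\<close>.
  By consistency the \<open>u\<^sub>\<iota>\<close> are bounded, uniformly in \<open>\<iota>\<close>, on the functionals \<open>\<nu>(x) T\<^sub>x\<close>, whose bipolar
  is \<open>B\<degree>\<close>; since \<open>u\<^sub>\<iota>\<close> is continuous for uniform convergence on absolutely convex compact sets,
  \<open>\<parallel>u\<^sub>\<iota> y\<parallel> \<le> C p(y)\<close>. As \<open>U\<close> is a set of uniqueness, the \<open>T\<^sub>x\<close> with \<open>x \<in> U\<close> separate the points of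
  \<open>B\<close>, so their span is \<open>p\<close>-dense, with finitely many \<open>x\<close> and bounded coefficients sufficing for a
  whole equicontinuous set. Hence \<open>u\<^sub>\<iota>\<close> is Cauchy uniformly on equicontinuous sets, its limit \<open>u\<close>
  satisfies the same bound, and \<open>f\<^sub>\<iota> \<rightarrow> S u\<close> by continuity of \<open>S\<close>. Both approximation statements are
  instances of one finite-dimensional separation argument, which avoids the Hahn-Banach and
  Mackey-Arens theorems.
\<close>

section \<open>The scalar field and separation in finite dimension\<close>

text \<open>Treats both scalar fields at once: the isometric copy inside the complex numbers is the
  real line or the whole plane, hence closed under conjugation. It supplies a real part and a
  conjugation, and so a Euclidean inner product on finite powers of the scalars.\<close>

lemma scalars_embed_complex:
  "\<exists>h :: 'k::real_or_complex \<Rightarrow> complex.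
     (\<forall>x y. h (x + y) = h x + h y) \<and> (\<forall>x y. h (x * y) = h x * h y) \<and>
     (\<forall>r. h (of_real r) = of_real r) \<and> (\<forall>x. cmod (h x) = norm x) \<and> (\<forall>x. \<exists>y. h y = cnj (h x))"
  using real_or_complex[where 'a='k]
proof
  assume "\<forall>z::'k. \<exists>r::real. z = r *\<^sub>R 1"
  then obtain \<rho> :: "'k \<Rightarrow> real" where \<rho>: "z = of_real (\<rho> z)" for z
    unfolding of_real_def[symmetric] by metis
  have eq: "of_real a = (of_real b :: 'k) \<Longrightarrow> a = b" for a b by simp
  show ?thesis
  proof (intro exI[of _ "\<lambda>z. complex_of_real (\<rho> z)"] conjI allI)
    fix x y :: 'k and r
    show "complex_of_real (\<rho> (x + y)) = of_real (\<rho> x) + of_real (\<rho> y)"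
      by (metis \<rho> eq of_real_add)
    show "complex_of_real (\<rho> (x * y)) = of_real (\<rho> x) * of_real (\<rho> y)"
      by (metis \<rho> eq of_real_mult)
    show "complex_of_real (\<rho> (of_real r)) = of_real r"
      by (metis \<rho> eq)
    show "cmod (complex_of_real (\<rho> x)) = norm x"
      by (metis \<rho> norm_of_real)
    show "\<exists>y. complex_of_real (\<rho> y) = cnj (of_real (\<rho> x))" by auto
  qed
next
  assume "\<exists>h::'k \<Rightarrow> complex. bij h \<and> (\<forall>x y. h (x + y) = h x + h y) \<and> (\<forall>x y. h (x * y) = h x * h y) \<and>
        (\<forall>r. h (r *\<^sub>R 1) = complex_of_real r) \<and> (\<forall>x. cmod (h x) = norm x)"
  then show ?thesis
    unfolding of_real_def[symmetric] by (metis bij_pointE)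
qed

text \<open>The ball is a continuous isometric image of the real interval or of the complex disc. It
  makes the unit polydisc compact in the separation argument.\<close>

lemma compact_unit_ball_scalars: "compact (cball (0::'k::real_or_complex) 1)"
  using real_or_complex[where 'a='k]
proof
  assume "\<forall>z::'k. \<exists>r::real. z = r *\<^sub>R 1"
  then have "cball (0::'k) 1 \<subseteq> of_real ` cball 0 1"
    unfolding of_real_def[symmetric] by (smt (verit) image_iff mem_cball_0 norm_of_real real_norm_def subsetI)
  then have "cball (0::'k) 1 = of_real ` cball 0 1" by auto
  then show ?thesis by (simp add: compact_continuous_image continuous_on_of_real)
next
  assume "\<exists>h::'k \<Rightarrow> complex. bij h \<and> (\<forall>x y. h (x + y) = h x + h y) \<and> (\<forall>x y. h (x * y) = h x * h y) \<and>
        (\<forall>r. h (r *\<^sub>R 1) = complex_of_real r) \<and> (\<forall>x. cmod (h x) = norm x)"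
  then obtain h :: "'k \<Rightarrow> complex" where h: "bij h" "\<And>x y. h (x + y) = h x + h y"
    "\<And>x. cmod (h x) = norm x" by blast
  define g where "g = inv h"
  have hg: "h (g z) = z" "g (h x) = x" for z x
    using h(1) by (simp_all add: g_def bij_is_surj surj_f_inv_f bij_is_inj)
  have g: "norm (g z) = cmod z" "g (w + z) = g w + g z" for w z
    by (metis hg(1) h(3)) (metis hg h(2))
  have "g (w - z) = g w - g z" for w z
    using g(2)[of "w - z" z] by simp
  then have "continuous_on (cball 0 1) g"
    unfolding continuous_on_iff dist_norm using g(1) by metis
  moreover have "x \<in> g ` cball 0 1" if "norm x \<le> 1" for x
    using that by (intro image_eqI[of _ g "h x"]) (simp_all add: hg h(3))
  then have "cball (0::'k) 1 = g ` cball 0 1"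
    using g(1) by auto
  ultimately show ?thesis by (simp add: compact_continuous_image)
qed

text \<open>The coefficients are the conjugates of \<open>t - Y k0\<close>, where \<open>Y k0\<close> is the point of the image that
  is nearest to \<open>t\<close> in the Euclidean norm.\<close>

lemma finite_separation:
  fixes Y :: "'j \<Rightarrow> 'z \<Rightarrow> 'k::real_or_complex"
  assumes K: "compactin Z K" "K \<noteq> {}" and J: "finite J"
    and Y: "\<And>j. j \<in> J \<Longrightarrow> continuous_map (subtopology Z K) euclidean (Y j)"
    and acx: "\<And>a b c d. \<lbrakk>a \<in> K; b \<in> K; norm c + norm d \<le> 1\<rbrakk>
                \<Longrightarrow> \<exists>k\<in>K. \<forall>j\<in>J. Y j k = c * Y j a + d * Y j b"
    and t: "\<And>k. k \<in> K \<Longrightarrow> \<exists>j\<in>J. Y j k \<noteq> t j"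
  shows "\<exists>c. \<forall>k\<in>K. norm (\<Sum>j\<in>J. c j * Y j k) < norm (\<Sum>j\<in>J. c j * t j)"
proof -
  obtain h :: "'k \<Rightarrow> complex" where h: "\<And>x y. h (x + y) = h x + h y" "\<And>x y. h (x * y) = h x * h y"
    "\<And>r. h (of_real r) = of_real r" "\<And>x. cmod (h x) = norm x" "\<And>x. \<exists>y. h y = cnj (h x)"
    using scalars_embed_complex by blast
  then obtain cn where cn: "\<And>x. h (cn x) = cnj (h x)" by metis
  define re where "re x = Re (h x)" for x
  have h0: "h 0 = 0" using h(3)[of 0] by simp
  have hdiff: "h (x - y) = h x - h y" for x y using h(1)[of "x - y" y] by simp
  have hsum: "h (sum g A) = (\<Sum>j\<in>A. h (g j))" for g :: "'j \<Rightarrow> 'k" and A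
    by (induction A rule: infinite_finite_induct) (auto simp: h h0)
  have resum: "re (sum g A) = (\<Sum>j\<in>A. re (g j))" for g :: "'j \<Rightarrow> 'k" and A
    by (simp add: re_def hsum)
  have re_le: "re x \<le> norm x" for x
    unfolding re_def h(4)[symmetric] by (rule complex_Re_le_cmod)
  have sq: "norm (x - of_real \<delta> * y)^2 = norm x^2 - 2 * \<delta> * re (cn x * y) + \<delta>^2 * norm y^2" for x y \<delta>
    unfolding h(4)[symmetric] re_def h(2,3) hdiff cn cmod_power2
    by (simp add: power2_eq_square algebra_simps)
  \<comment> \<open>The squared Euclidean distance from \<open>t\<close> to the image point of
    \<open>k\<close>. Compactness of \<open>K\<close> yields a minimiser \<open>k0\<close>.\<close>
  define G where "G k = (\<Sum>j\<in>J. (norm (t j - Y j k))^2)" for k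
  have "continuous_map (subtopology Z K) euclideanreal G"
    unfolding G_def
    by (intro continuous_map_sum continuous_map_real_pow continuous_map_norm continuous_map_diff Y J)
       simp
  then have "compactin euclideanreal (G ` K)"
    by (rule image_compactin[rotated]) (simp add: compactin_subtopology K)
  then obtain k0 where k0: "k0 \<in> K" "\<And>k. k \<in> K \<Longrightarrow> G k0 \<le> G k"
    using K(2) compact_attains_inf[of "G ` K"] by auto
  define r where "r j = t j - Y j k0" for j
  define \<phi> where "\<phi> k = (\<Sum>j\<in>J. cn (r j) * Y j k)" for k
  \<comment> \<open>Variational inequality at the nearest point: moving from the image of
    \<open>k0\<close> towards that of \<open>k\<close> by a fraction \<delta> cannot decrease the
    distance. Expanding the square with \<open>sq\<close> gives
    \<open>2 * A \<le> \<delta> * D\<close>.\<close>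
  have max: "re (\<phi> k) \<le> re (\<phi> k0)" if "k \<in> K" for k
  proof -
    define A where "A = (\<Sum>j\<in>J. re (cn (r j) * (Y j k - Y j k0)))"
    define D where "D = (\<Sum>j\<in>J. norm (Y j k - Y j k0)^2)"
    have D0: "D \<ge> 0" by (simp add: D_def sum_nonneg)
    have A_le: "2 * A \<le> \<delta> * D" if \<delta>: "0 < \<delta>" "\<delta> \<le> 1" for \<delta>
    proof -
      have "norm (of_real (1 - \<delta>) :: 'k) + norm (of_real \<delta> :: 'k) \<le> 1"
        unfolding norm_of_real using \<delta> by simp
      from acx[OF k0(1) \<open>k \<in> K\<close> this] obtain k' where k': "k' \<in> K"
        "\<And>j. j \<in> J \<Longrightarrow> Y j k' = of_real (1 - \<delta>) * Y j k0 + of_real \<delta> * Y j k" by blast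
      have eq: "t j - Y j k' = r j - of_real \<delta> * (Y j k - Y j k0)" if "j \<in> J" for j
        by (simp add: k'(2)[OF that] r_def algebra_simps)
      have "G k0 \<le> G k'" by (rule k0) fact
      also have "G k' = (\<Sum>j\<in>J. norm (r j)^2 - 2 * \<delta> * re (cn (r j) * (Y j k - Y j k0)) + \<delta>^2 * norm (Y j k - Y j k0)^2)"
        unfolding G_def by (rule sum.cong) (simp_all only: eq sq)
      also have "\<dots> = G k0 - 2 * \<delta> * A + \<delta>^2 * D"
        by (simp add: sum.distrib sum_subtractf sum_distrib_left A_def D_def G_def r_def)
      finally have "\<delta> * (2 * A) \<le> \<delta> * (\<delta> * D)" by (simp add: power2_eq_square)
      then show ?thesis using \<delta> by simp
    qed
    have "A \<le> 0"
    proof (rule ccontr)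
      assume "\<not> A \<le> 0"
      \<comment> \<open>For \<open>A > 0\<close> this value of \<delta> is admissible and turns the
        inequality into \<open>2 * (D + A) \<le> D\<close>, which is impossible.\<close>
      with D0 have "A / (D + A) > 0" "A / (D + A) \<le> 1" "D + A > 0" by (auto simp: field_simps)
      with A_le[of "A / (D + A)"] have "A * (2 * (D + A)) \<le> A * D" by (simp add: field_simps)
      with D0 \<open>\<not> A \<le> 0\<close> show False by simp
    qed
    moreover have "A = re (\<phi> k) - re (\<phi> k0)"
      unfolding A_def \<phi>_def resum sum_subtractf[symmetric]
      by (simp add: re_def right_diff_distrib hdiff)
    ultimately show ?thesis by simp
  qed
  have le: "norm (\<phi> k) \<le> re (\<phi> k0)" if k: "k \<in> K" for k
  proof -
    \<comment> \<open>The phase that rotates \<open>\<phi> k\<close> onto the nonnegative real axis,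
      so that a bound on real parts becomes a bound on norms. For \<open>\<phi> k = 0\<close> the
      quotient is \<open>0\<close>, still an admissible coefficient.\<close>
    define \<theta> where "\<theta> = of_real (norm (\<phi> k)) / \<phi> k"
    have "norm \<theta> + norm (0::'k) \<le> 1"
      by (simp add: \<theta>_def norm_divide)
    from acx[OF k k this] obtain k' where k': "k' \<in> K" "\<And>j. j \<in> J \<Longrightarrow> Y j k' = \<theta> * Y j k" by auto
    have "\<phi> k' = \<theta> * \<phi> k"
      unfolding \<phi>_def sum_distrib_left by (rule sum.cong) (auto simp: k'(2))
    also have "\<dots> = of_real (norm (\<phi> k))" by (simp add: \<theta>_def)
    finally have "re (\<phi> k') = norm (\<phi> k)" by (simp add: re_def h(3))
    with max[OF k'(1)] show ?thesis by simp
  qed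
  obtain j where j: "j \<in> J" "r j \<noteq> 0" using t[OF k0(1)] by (auto simp: r_def)
  \<comment> \<open>The gap is strict because the real part of the functional at \<open>t\<close>
    exceeds its value at the image of \<open>k0\<close> by exactly the squared length of
    \<open>r\<close>, and \<open>t\<close> is not in the image of \<open>K\<close>.\<close>
  have "0 < (\<Sum>j\<in>J. (norm (r j))^2)"
    by (rule sum_pos2[OF J j(1)]) (use j in auto)
  also have "\<dots> = (\<Sum>j\<in>J. re (cn (r j) * r j))"
    unfolding re_def h(2) cn h(4)[symmetric] cmod_power2
    by (simp add: power2_eq_square)
  also have "\<dots> = re (\<Sum>j\<in>J. cn (r j) * t j) - re (\<phi> k0)"
    unfolding \<phi>_def resum sum_subtractf[symmetric]
    by (simp add: re_def right_diff_distrib hdiff r_def[of j for j] h(2))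
  finally have "re (\<phi> k0) < norm (\<Sum>j\<in>J. cn (r j) * t j)"
    using re_le[of "\<Sum>j\<in>J. cn (r j) * t j"] by simp
  then show ?thesis
    using le unfolding \<phi>_def by (intro exI[of _ "\<lambda>j. cn (r j)"]) fastforce
qed

section \<open>Duals of locally convex spaces and approximation of functionals on compact
  sets\<close>

lemma continuous_map_mult_algebra:
  fixes f g :: "'a \<Rightarrow> 'b::real_normed_algebra"
  shows "\<lbrakk>continuous_map X euclidean f; continuous_map X euclidean g\<rbrakk>
    \<Longrightarrow> continuous_map X euclidean (\<lambda>x. f x * g x)"
  by (simp add: continuous_map_atin tendsto_mult)

lemma continuous_map_of_real:
  "continuous_map X euclideanreal f
    \<Longrightarrow> continuous_map X euclidean (\<lambda>x. of_real (f x) :: 'b::real_normed_algebra_1)"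
  by (simp add: continuous_map_atin tendsto_of_real)

lemma compactin_finite_subcover:
  assumes "compactin X K" "\<And>i. i \<in> A \<Longrightarrow> openin X (V i)" "K \<subseteq> (\<Union>i\<in>A. V i)"
  obtains F where "finite F" "F \<subseteq> A" "K \<subseteq> (\<Union>i\<in>F. V i)"
proof -
  have "\<exists>\<F>. finite \<F> \<and> \<F> \<subseteq> V ` A \<and> K \<subseteq> \<Union>\<F>"
    using assms(1)[unfolded compactin_def, THEN conjunct2, rule_format, of "V ` A"] assms(2,3) by simp
  then obtain \<F> where \<F>: "finite \<F>" "\<F> \<subseteq> V ` A" "K \<subseteq> \<Union>\<F>" by blast
  obtain F where "F \<subseteq> A" "finite F" "\<F> = V ` F" using finite_subset_image[OF \<F>(1,2)] by blast
  with \<F>(3) show ?thesis by (intro that) auto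
qed

lemma lcHsD:
  assumes "lcHs s X"
  shows lcHs_module: "module s"
    and lcHs_combination: "\<And>a b c d. \<lbrakk>a \<in> topspace X; b \<in> topspace X\<rbrakk> \<Longrightarrow> s c a + s d b \<in> topspace X"
    and lcHs_scale: "\<And>a c. a \<in> topspace X \<Longrightarrow> s c a \<in> topspace X"
    and lcHs_zero: "0 \<in> topspace X"
    and lcHs_continuous_add: "continuous_map (prod_topology X X) X (\<lambda>(x, y). x + y)"
    and lcHs_continuous_scale: "continuous_map (prod_topology euclidean X) X (\<lambda>(c, x). s c x)"
proof -
  have m: "module s" and sub: "module.subspace s (topspace X)"
    using assms by (auto simp: lcHs_def)
  show "module s" by (rule m)
  show "s c a \<in> topspace X" if "a \<in> topspace X" for a c
    using that by (rule module.subspace_scale[OF m sub])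
  then show "s c a + s d b \<in> topspace X" if "a \<in> topspace X" "b \<in> topspace X" for a b c d
    using that module.subspace_add[OF m sub] by blast
  show "0 \<in> topspace X" by (rule module.subspace_0[OF m sub])
  show "continuous_map (prod_topology X X) X (\<lambda>(x, y). x + y)"
    "continuous_map (prod_topology euclidean X) X (\<lambda>(c, x). s c x)"
    using assms by (auto simp: lcHs_def)
qed

lemma dual_continuous: "y \<in> dual s X \<Longrightarrow> continuous_map X euclidean y"
  by (simp add: dual_def)

lemma dual_scale_arg: "\<lbrakk>y \<in> dual s X; a \<in> topspace X\<rbrakk> \<Longrightarrow> y (s c a) = c * y a"
  by (simp add: dual_def linear_on_def)

lemma dual_combination_arg:
  assumes "lcHs s X" "y \<in> dual s X" "a \<in> topspace X" "b \<in> topspace X"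
  shows "y (s c a + s d b) = c * y a + d * y b"
  using assms lcHs_scale[OF assms(1)] by (simp add: dual_def linear_on_def)

lemma dual_add: "\<lbrakk>y \<in> dual s X; z \<in> dual s X\<rbrakk> \<Longrightarrow> y + z \<in> dual s X"
  unfolding dual_def linear_on_def plus_fun_def
  by (simp add: continuous_map_add distrib_left add_ac)

lemma dual_fscale: "y \<in> dual s X \<Longrightarrow> fscale times c y \<in> dual s X"
  unfolding dual_def linear_on_def fscale_def
  by (simp add: continuous_map_mult_algebra distrib_left mult_ac)

lemma dual_zero: "0 \<in> dual s X"
  by (simp add: dual_def linear_on_def zero_fun_def)

lemma dual_diff: "\<lbrakk>y \<in> dual s X; z \<in> dual s X\<rbrakk> \<Longrightarrow> y - z \<in> dual s X"
proof -
  assume "y \<in> dual s X" "z \<in> dual s X"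
  moreover have "y - z = y + fscale times (-1) z"
    by (auto simp: fscale_def fun_eq_iff)
  ultimately show "y - z \<in> dual s X"
    by (metis dual_add dual_fscale)
qed

lemma dual_sum:
  "(\<And>j. j \<in> J \<Longrightarrow> g j \<in> dual s X) \<Longrightarrow> (\<Sum>j\<in>J. g j) \<in> dual s X"
  by (induction J rule: infinite_finite_induct) (auto intro: dual_add dual_zero)

lemma sum_fscale_apply: "(\<Sum>j\<in>J. fscale times (c j) (g j)) k = (\<Sum>j\<in>J. c j * g j k)"
  by (induction J rule: infinite_finite_induct) (auto simp: fscale_def)

text \<open>Dividing by \<open>\<alpha>\<close> is harmless: for \<open>\<alpha> = 0\<close> both weights vanish.\<close>

lemma absolutely_convex_weighted:
  assumes X: "lcHs s X" and K: "absolutely_convex s K" "K \<subseteq> topspace X" "a \<in> K" "b \<in> K"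
    and \<alpha>: "norm c + norm d \<le> \<alpha>"
  obtains k where "k \<in> K" "\<And>y. y \<in> dual s X \<Longrightarrow> of_real \<alpha> * y k = c * y a + d * y b"
proof
  have "norm c / \<bar>\<alpha>\<bar> + norm d / \<bar>\<alpha>\<bar> \<le> 1"
    using \<alpha> norm_ge_zero[of c] norm_ge_zero[of d]
    by (cases "\<alpha> = 0") (auto simp: add_divide_distrib[symmetric] simp del: norm_ge_zero)
  then show "s (c / of_real \<alpha>) a + s (d / of_real \<alpha>) b \<in> K"
    using K unfolding absolutely_convex_def by (auto simp: norm_divide)
  have "\<alpha> = 0 \<Longrightarrow> c = 0 \<and> d = 0"
    using \<alpha> norm_ge_zero[of c] norm_ge_zero[of d] norm_eq_zero[of c] norm_eq_zero[of d] by argo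
  then show "of_real \<alpha> * y (s (c / of_real \<alpha>) a + s (d / of_real \<alpha>) b) = c * y a + d * y b"
    if "y \<in> dual s X" for y
    using that K by (auto simp: dual_combination_arg[OF X that] subset_iff distrib_left)
qed

text \<open>Separate \<open>(\<epsilon>, 0)\<close> from the absolutely convex hull of the image of \<open>K\<close> under \<open>(y, g)\<close> and of
  \<open>{0} \<times> \<epsilon>D\<close>, where \<open>D\<close> is the unit polydisc. The separating functional is a multiple of
  \<open>(1, -c)\<close>: the first set gives the error bound and the second the bound on \<open>\<Sum> |c\<^sub>j|\<close>.\<close>

lemma functional_approximation:
  fixes s :: "'k::real_or_complex \<Rightarrow> 'x::ab_group_add \<Rightarrow> 'x" and J :: "'j set"
  assumes X: "lcHs s X" and K: "compactin X K" "absolutely_convex s K"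
    and y: "y \<in> dual s X" and J: "finite J" and g: "\<And>j. j \<in> J \<Longrightarrow> g j \<in> dual s X"
    and \<epsilon>: "\<epsilon> > 0"
    and dom: "\<And>k. k \<in> K \<Longrightarrow> norm (y k) < \<epsilon> \<or> (\<exists>j\<in>J. norm (y k) < \<epsilon> + norm (g j k))"
  shows "\<exists>c. (\<Sum>j\<in>J. norm (c j)) \<le> 1 \<and> (\<forall>k\<in>K. norm (y k - (\<Sum>j\<in>J. c j * g j k)) \<le> \<epsilon>)"
proof (cases "K = {}")
  case True
  then show ?thesis by (intro exI[of _ "\<lambda>_. 0"]) auto
next
  case False
  have KX: "K \<subseteq> topspace X" by (rule compactin_subset_topspace) fact
  define Z where "Z = prod_topology X (prod_topology (product_topology (\<lambda>_. euclidean :: 'k topology) J) euclideanreal)"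
  \<comment> \<open>\<open>Q\<close> parametrises the hull: \<open>(k, w, \<alpha>)\<close> stands
    for \<alpha> times the image of \<open>k\<close> plus \<open>1 - \<alpha>\<close> times the
    point of the polydisc given by \<epsilon> and \<open>w\<close>. Compactness thus comes from a
    product of compact sets. Coordinate \<open>None\<close> carries \<open>y\<close>, coordinate
    \<open>Some j\<close> carries \<open>g j\<close>.\<close>
  define Q where "Q = K \<times> ((\<Pi>\<^sub>E j\<in>J. cball (0::'k) 1) \<times> {0..1::real})"
  define Y :: "'j option \<Rightarrow> 'x \<times> ('j \<Rightarrow> 'k) \<times> real \<Rightarrow> 'k" where
    "Y i = (\<lambda>(k, w, \<alpha>). case i of None \<Rightarrow> of_real \<alpha> * y k
        | Some j \<Rightarrow> of_real \<alpha> * g j k + of_real (\<epsilon> * (1 - \<alpha>)) * w j)" for i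
  let ?J = "insert None (Some ` J)"
  define t :: "'j option \<Rightarrow> 'k" where "t i = (if i = None then of_real \<epsilon> else 0)" for i
  obtain k0 where "k0 \<in> K" using False by blast
  then have "(k0, \<lambda>j\<in>J. 0, 0) \<in> Q" by (simp add: Q_def)
  then have Q_ne: "Q \<noteq> {}" by blast
  have Q: "compactin Z Q"
    unfolding Z_def Q_def compactin_Times compactin_PiE
    using K compact_unit_ball_scalars by auto
  have cont: "continuous_map Z euclidean (Y i)" if "i \<in> ?J" for i
  proof -
    have 1: "continuous_map Z euclidean (\<lambda>q. z (fst q))" if "z \<in> dual s X" for z
      using continuous_map_compose[OF continuous_map_fst dual_continuous[OF that]]
      unfolding Z_def o_def .
    have 2: "continuous_map Z euclideanreal (\<lambda>q. snd (snd q))"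
      using continuous_map_compose[OF continuous_map_snd continuous_map_snd]
      unfolding Z_def o_def .
    have 3: "continuous_map Z euclidean (\<lambda>q. fst (snd q) j)" if "j \<in> J" for j
      using continuous_map_compose[OF continuous_map_compose[OF continuous_map_snd continuous_map_fst]
        continuous_map_product_projection[OF that]]
      unfolding Z_def o_def .
    show ?thesis
      using that y g unfolding Y_def case_prod_beta
      by (auto simp del: of_real_diff of_real_mult intro!: continuous_map_add continuous_map_mult_algebra
        continuous_map_of_real continuous_map_real_mult continuous_map_diff 1 2 3)
  qed
  have acx: "\<exists>q\<in>Q. \<forall>i\<in>?J. Y i q = c * Y i a + d * Y i b"
    if "a \<in> Q" "b \<in> Q" and cd: "norm c + norm d \<le> 1" for a b c d
  proof -
    obtain k1 w1 \<alpha>1 k2 w2 \<alpha>2 where ab: "a = (k1, w1, \<alpha>1)" "b = (k2, w2, \<alpha>2)" by (metis prod.exhaust)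
    with that have k: "k1 \<in> K" "k2 \<in> K" and w: "\<And>j. j \<in> J \<Longrightarrow> norm (w1 j) \<le> 1" "\<And>j. j \<in> J \<Longrightarrow> norm (w2 j) \<le> 1"
      and \<alpha>12: "0 \<le> \<alpha>1" "\<alpha>1 \<le> 1" "0 \<le> \<alpha>2" "\<alpha>2 \<le> 1"
      by (auto simp: Q_def PiE_iff)
    \<comment> \<open>The weight that falls on \<open>K\<close> in the combination. The weight left
      for the polydisc is \<open>(norm c + norm d) - \<alpha>\<close>, which is at most
      \<open>1 - \<alpha>\<close>.\<close>
    define \<alpha> where "\<alpha> = norm c * \<alpha>1 + norm d * \<alpha>2"
    have "norm c * \<alpha>1 \<le> norm c" "norm d * \<alpha>2 \<le> norm d"
      using \<alpha>12 by (simp_all add: mult_left_le)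
    then have \<alpha>: "0 \<le> \<alpha>" "\<alpha> \<le> 1"
      using cd \<alpha>12 by (simp_all add: \<alpha>_def)
    have "norm (c * of_real \<alpha>1) + norm (d * of_real \<alpha>2) \<le> \<alpha>"
      using \<alpha>12 by (simp add: norm_mult \<alpha>_def)
    then obtain k where k': "k \<in> K"
      "\<And>y. y \<in> dual s X \<Longrightarrow> of_real \<alpha> * y k = c * of_real \<alpha>1 * y k1 + d * of_real \<alpha>2 * y k2"
      using absolutely_convex_weighted[OF X K(2) KX k] by blast
    define v where "v j = c * (of_real (\<epsilon> * (1 - \<alpha>1)) * w1 j) + d * (of_real (\<epsilon> * (1 - \<alpha>2)) * w2 j)" for j
    \<comment> \<open>For \<open>\<alpha> = 1\<close> the bound on \<open>v\<close> forces
      \<open>v j = 0\<close>, which agrees with division by zero giving \<open>0\<close>.\<close>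
    define w' where "w' = (\<lambda>j\<in>J. v j / of_real (\<epsilon> * (1 - \<alpha>)))"
    have v: "norm (v j) \<le> \<epsilon> * (1 - \<alpha>)" if "j \<in> J" for j
    proof -
      have *: "norm (x * (of_real (\<epsilon> * (1 - \<beta>)) * z)) \<le> \<epsilon> * (norm x * (1 - \<beta>))"
        if "\<beta> \<le> 1" "norm z \<le> 1" for x z :: 'k and \<beta>
      proof -
        have "norm x * (1 - \<beta>) * norm z \<le> norm x * (1 - \<beta>)"
          using that by (intro mult_left_le) auto
        then show ?thesis
          using \<epsilon> that by (simp add: norm_mult mult_ac del: of_real_mult of_real_diff)
      qed
      have "norm (v j) \<le> \<epsilon> * (norm c * (1 - \<alpha>1)) + \<epsilon> * (norm d * (1 - \<alpha>2))"
        unfolding v_def using w[OF that] \<alpha>12 by (intro norm_triangle_mono *)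
      also have "\<dots> = \<epsilon> * ((norm c + norm d) - \<alpha>)" by (simp add: \<alpha>_def algebra_simps)
      also have "\<dots> \<le> \<epsilon> * (1 - \<alpha>)" using cd \<epsilon> by simp
      finally show ?thesis .
    qed
    have w': "of_real (\<epsilon> * (1 - \<alpha>)) * w' j = v j" "norm (w' j) \<le> 1" if "j \<in> J" for j
    proof -
      show "of_real (\<epsilon> * (1 - \<alpha>)) * w' j = v j"
        using v[OF that] that \<epsilon> by (cases "\<alpha> = 1") (auto simp: w'_def simp del: of_real_diff of_real_mult)
      show "norm (w' j) \<le> 1"
        using v[OF that] that \<alpha> \<epsilon> by (cases "\<alpha> = 1") (auto simp: w'_def norm_divide simp del: of_real_diff of_real_mult)
    qed
    have Yeq: "Y i (k, w', \<alpha>) = c * Y i a + d * Y i b" if "i \<in> ?J" for i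
    proof (cases i)
      case None
      then show ?thesis using k'(2)[OF y] by (simp add: Y_def ab mult.assoc)
    next
      case (Some j)
      with that have j: "j \<in> J" by auto
      show ?thesis
        unfolding Y_def ab Some prod.case option.case k'(2)[OF g[OF j]] w'(1)[OF j] v_def
        by (simp only: distrib_left mult.assoc add_ac)
    qed
    have "(k, w', \<alpha>) \<in> Q"
      using k'(1) \<alpha> w'(2) by (auto simp: Q_def w'_def)
    with Yeq show ?thesis by blast
  qed
  \<comment> \<open>If the hull met \<open>t\<close>, then
    \<open>\<alpha> * norm (y k) = \<epsilon>\<close> and
    \<open>\<alpha> * norm (g j k) \<le> \<epsilon> * (1 - \<alpha>)\<close>. Dividing by \<alpha>
    would give \<open>norm (y k) \<ge> \<epsilon>\<close> and
    \<open>norm (y k) \<ge> \<epsilon> + norm (g j k)\<close> for every \<open>j\<close>, against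
    \<open>dom\<close>.\<close>
  have avoid: "\<exists>i\<in>?J. Y i q \<noteq> t i" if "q \<in> Q" for q
  proof (rule ccontr)
    assume neg: "\<not> ?thesis"
    obtain k w \<alpha> where q: "q = (k, w, \<alpha>)" by (metis prod.exhaust)
    from that have k: "k \<in> K" and w: "\<And>j. j \<in> J \<Longrightarrow> norm (w j) \<le> 1" and \<alpha>: "0 \<le> \<alpha>" "\<alpha> \<le> 1"
      by (auto simp: Q_def q)
    have "of_real \<alpha> * y k = of_real \<epsilon>"
      using neg by (auto simp: Y_def q t_def)
    then have "norm (of_real \<alpha> * y k) = norm (of_real \<epsilon> :: 'k)" by simp
    then have yk: "\<alpha> * norm (y k) = \<epsilon>" using \<alpha> \<epsilon> by (simp add: norm_mult)
    have gk: "\<alpha> * norm (g j k) \<le> \<epsilon> * (1 - \<alpha>)" if j: "j \<in> J" for j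
    proof -
      have "of_real \<alpha> * g j k = - (of_real (\<epsilon> * (1 - \<alpha>)) * w j)"
        using neg j unfolding eq_neg_iff_add_eq_0 by (auto simp: Y_def q t_def)
      then have "norm (of_real \<alpha> * g j k) = norm (of_real (\<epsilon> * (1 - \<alpha>)) * w j)" by simp
      then have "\<alpha> * norm (g j k) = \<epsilon> * (1 - \<alpha>) * norm (w j)"
        using \<alpha> \<epsilon> by (simp add: norm_mult del: of_real_diff of_real_mult)
      also have "\<dots> \<le> \<epsilon> * (1 - \<alpha>)" using w[OF j] \<alpha> \<epsilon> by (intro mult_left_le) auto
      finally show ?thesis .
    qed
    have \<alpha>0: "\<alpha> > 0" using yk \<epsilon> \<alpha> by (cases "\<alpha> = 0") auto
    from dom[OF k] show False
    proof
      assume "norm (y k) < \<epsilon>"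
      then have "\<alpha> * norm (y k) < \<alpha> * \<epsilon>" using \<alpha>0 by simp
      also have "\<dots> \<le> 1 * \<epsilon>" using \<alpha> \<epsilon> by (intro mult_right_mono) auto
      finally show False using yk by simp
    next
      assume "\<exists>j\<in>J. norm (y k) < \<epsilon> + norm (g j k)"
      then obtain j where j: "j \<in> J" "norm (y k) < \<epsilon> + norm (g j k)" by blast
      then have "\<alpha> * norm (y k) < \<alpha> * (\<epsilon> + norm (g j k))" using \<alpha>0 by simp
      with gk[OF j(1)] yk show False by (simp add: algebra_simps)
    qed
  qed
  obtain c where c: "\<And>q. q \<in> Q \<Longrightarrow> norm (\<Sum>i\<in>?J. c i * Y i q) < norm (\<Sum>i\<in>?J. c i * t i)"
  proof -
    have "\<exists>c. \<forall>q\<in>Q. norm (\<Sum>i\<in>?J. c i * Y i q) < norm (\<Sum>i\<in>?J. c i * t i)"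
    proof (rule finite_separation[OF Q Q_ne])
      show "finite ?J" using J by simp
      show "continuous_map (subtopology Z Q) euclidean (Y i)" if "i \<in> ?J" for i
        by (rule continuous_map_from_subtopology[OF cont[OF that]])
    qed (fact acx avoid)+
    then show ?thesis by (auto intro: that)
  qed
  have sum_J: "(\<Sum>i\<in>?J. h i) = h None + (\<Sum>j\<in>J. h (Some j))" for h :: "'j option \<Rightarrow> 'k"
    using J by (simp add: sum.reindex)
  have lt: "norm (c None * Y None q + (\<Sum>j\<in>J. c (Some j) * Y (Some j) q)) < norm (c None) * \<epsilon>" if "q \<in> Q" for q
    using c[OF that] \<epsilon> unfolding sum_J by (simp add: t_def norm_mult)
  have "0 < norm (c None) * \<epsilon>"
    using Q_ne lt by (meson ex_in_conv le_less_trans norm_ge_zero)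
  then have c0: "norm (c None) > 0" using \<epsilon> by (simp add: zero_less_mult_iff)
  show ?thesis
  proof (intro exI[of _ "\<lambda>j. - (c (Some j) / c None)"] conjI ballI)
    \<comment> \<open>The point of the polydisc at which every term \<open>c (Some j) * w j\<close>
      is the modulus of its coefficient; where the coefficient vanishes, the quotient is
      \<open>0\<close>. With weight \<open>0\<close> on \<open>K\<close> it yields the bound on the
      coefficient sum.\<close>
    define w where "w = (\<lambda>j\<in>J. of_real (norm (c (Some j))) / c (Some j))"
    have cw: "c (Some j) * w j = of_real (norm (c (Some j)))" if "j \<in> J" for j
      using that by (simp add: w_def)
    obtain k where "k \<in> K" using False by blast
    then have "(k, w, 0) \<in> Q" by (auto simp: Q_def w_def norm_divide)
    from lt[OF this] have "norm (\<Sum>j\<in>J. of_real \<epsilon> * (c (Some j) * w j)) < norm (c None) * \<epsilon>"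
      by (simp add: Y_def mult_ac)
    also have "(\<Sum>j\<in>J. of_real \<epsilon> * (c (Some j) * w j)) = of_real (\<epsilon> * (\<Sum>j\<in>J. norm (c (Some j))))"
      by (simp add: cw sum_distrib_left)
    finally have "(\<Sum>j\<in>J. norm (c (Some j))) < norm (c None)"
      using \<epsilon> by (simp add: abs_mult sum_nonneg del: of_real_mult of_real_sum)
    then show "(\<Sum>j\<in>J. norm (- (c (Some j) / c None))) \<le> 1"
      using c0 by (simp add: norm_divide sum_divide_distrib[symmetric])
  next
    fix k assume "k \<in> K"
    then have "(k, \<lambda>j\<in>J. 0, 1) \<in> Q" by (auto simp: Q_def)
    from lt[OF this] have "norm (c None * y k + (\<Sum>j\<in>J. c (Some j) * g j k)) < norm (c None) * \<epsilon>"
      by (simp add: Y_def)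
    also have "c None * y k + (\<Sum>j\<in>J. c (Some j) * g j k)
        = c None * (y k - (\<Sum>j\<in>J. - (c (Some j) / c None) * g j k))"
      using c0 by (simp add: sum_negf sum_distrib_left distrib_left)
    finally show "norm (y k - (\<Sum>j\<in>J. - (c (Some j) / c None) * g j k)) \<le> \<epsilon>"
      using c0 by (simp add: norm_mult)
  qed
qed

section \<open>Linear maps on the dual and compact absolutely convex sets\<close>

lemma dual_map_zero:
  assumes "linear_on (fscale times) sE (dual s X) u"
  shows "u 0 = 0"
  using assms dual_zero[of s X] unfolding linear_on_def by (metis add_cancel_right_left)

lemma dual_map_diff:
  assumes "linear_on (fscale times) sE (dual s X) u" "y \<in> dual s X" "z \<in> dual s X"
  shows "u (y - z) = u y - u z"
proof -
  have "u y = u (y - z) + u z"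
    using assms(1) dual_diff[OF assms(2,3)] assms(3) unfolding linear_on_def
    by (metis diff_add_cancel)
  then show ?thesis by simp
qed

lemma norm_dual_map_fscale:
  assumes "linear_on (fscale times) sE (dual s X) u" "normed_space_over sE" "y \<in> dual s X"
  shows "norm (u (fscale times c y)) = norm c * norm (u y)"
  using assms unfolding linear_on_def normed_space_over_def by simp

lemma norm_dual_map_sum_le:
  assumes u: "linear_on (fscale times) sE (dual s X) u" and E: "normed_space_over sE"
    and g: "\<And>j. j \<in> J \<Longrightarrow> g j \<in> dual s X"
  shows "norm (u (\<Sum>j\<in>J. fscale times (c j) (g j))) \<le> (\<Sum>j\<in>J. norm (c j) * norm (u (g j)))"
  using g
proof (induction J rule: infinite_finite_induct)
  case (insert j J)
  have "u (\<Sum>i\<in>insert j J. fscale times (c i) (g i))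
      = u (fscale times (c j) (g j)) + u (\<Sum>i\<in>J. fscale times (c i) (g i))"
    using insert u by (simp add: linear_on_def dual_fscale dual_sum)
  then have "norm (u (\<Sum>i\<in>insert j J. fscale times (c i) (g i)))
      \<le> norm (u (fscale times (c j) (g j))) + norm (u (\<Sum>i\<in>J. fscale times (c i) (g i)))"
    by (simp only: norm_triangle_ineq)
  also have "\<dots> \<le> norm (c j) * norm (u (g j)) + (\<Sum>i\<in>J. norm (c i) * norm (u (g i)))"
    using insert by (simp add: norm_dual_map_fscale[OF u E])
  finally show ?case by (simp only: sum.insert insert.hyps not_False_eq_True)
qed (auto simp: dual_map_zero[OF u])

text \<open>Homogeneity: scaling \<open>y\<close> by \<open>\<delta> / \<epsilon>\<close> moves it
  to where \<open>bound\<close> applies. The supremum seminorm over \<open>K\<close> enters only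
  through its positive upper bounds \<epsilon>, which also covers functionals vanishing on
  \<open>K\<close>.\<close>

lemma norm_dual_map_le:
  assumes u: "linear_on (fscale times) sE (dual s X) u" and E: "normed_space_over sE"
    and bound: "\<And>y. \<lbrakk>y \<in> dual s X; \<forall>k\<in>K. norm (y k) \<le> \<delta>\<rbrakk> \<Longrightarrow> norm (u y) \<le> C"
    and \<delta>: "\<delta> > 0" and y: "y \<in> dual s X" "\<forall>k\<in>K. norm (y k) \<le> \<epsilon>" and \<epsilon>: "\<epsilon> > 0"
  shows "norm (u y) \<le> C / \<delta> * \<epsilon>"
proof -
  have "\<forall>k\<in>K. norm (fscale times (of_real (\<delta> / \<epsilon>)) y k) \<le> \<delta>"
    using y(2) \<delta> \<epsilon> by (auto simp: fscale_def norm_mult norm_divide field_simps simp del: of_real_divide)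
  from bound[OF dual_fscale[OF y(1)] this] show ?thesis
    using \<delta> \<epsilon> unfolding norm_dual_map_fscale[OF u E y(1)] norm_of_real
    by (simp add: field_simps)
qed

lemma compact_absolutely_convex_sum:
  fixes s :: "'k::real_normed_field \<Rightarrow> 'x::ab_group_add \<Rightarrow> 'x"
  assumes X: "lcHs s X"
    and A: "compactin X A" "absolutely_convex s A" and B: "compactin X B" "absolutely_convex s B"
  shows "compactin X ((\<lambda>(a, b). a + b) ` (A \<times> B)) \<and> absolutely_convex s ((\<lambda>(a, b). a + b) ` (A \<times> B))"
proof
  show "compactin X ((\<lambda>(a, b). a + b) ` (A \<times> B))"
    using A B by (intro image_compactin[OF _ lcHs_continuous_add[OF X]]) (simp add: compactin_Times)
  show "absolutely_convex s ((\<lambda>(a, b). a + b) ` (A \<times> B))"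
    unfolding absolutely_convex_def
  proof clarify
    fix c d :: 'k and a b a' b'
    assume "a \<in> A" "b \<in> B" "a' \<in> A" "b' \<in> B" "norm c + norm d \<le> 1"
    then have "s c a + s d a' \<in> A" "s c b + s d b' \<in> B"
      using A B by (auto simp: absolutely_convex_def)
    moreover have "s c (a + b) + s d (a' + b') = (s c a + s d a') + (s c b + s d b')"
      using module.scale_right_distrib[OF lcHs_module[OF X]] by (simp add: add_ac)
    ultimately show "s c (a + b) + s d (a' + b') \<in> (\<lambda>(a, b). a + b) ` (A \<times> B)" by force
  qed
qed

lemma absolutely_convex_zero:
  assumes "module s" "absolutely_convex s A" "A \<noteq> {}"
  shows "0 \<in> A"
proof -
  obtain a where a: "a \<in> A" using assms(3) by blast
  have "s 0 a + s 0 a \<in> A"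
    using assms(2) a by (simp add: absolutely_convex_def)
  then show ?thesis using module.scale_zero_left[OF assms(1)] by simp
qed

text \<open>Nonempty absolutely convex sets contain \<open>0\<close>, so a Minkowski sum contains
  its summands; the induction starts at \<open>{0}\<close> and skips empty members. The finite
  family of a basic neighbourhood in \<open>dual_kappa\<close> is thereby replaced by one compact
  set.\<close>

lemma compact_absolutely_convex_upper_bound:
  assumes X: "lcHs s X"
    and "finite \<A>" "\<And>A. A \<in> \<A> \<Longrightarrow> compactin X A \<and> absolutely_convex s A"
  obtains K where "compactin X K" "absolutely_convex s K" "\<And>A. A \<in> \<A> \<Longrightarrow> A \<subseteq> K" "K \<noteq> {}"
proof -
  have m: "module s" using X by (rule lcHs_module)
  from assms(2,3) have "\<exists>K. compactin X K \<and> absolutely_convex s K \<and> (\<forall>A\<in>\<A>. A \<subseteq> K) \<and> K \<noteq> {}"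
  proof (induction \<A> rule: finite_induct)
    case empty
    have "absolutely_convex s {0}"
      using module.scale_zero_right[OF m] by (simp add: absolutely_convex_def)
    then show ?case using lcHs_zero[OF X] by (intro exI[of _ "{0}"]) auto
  next
    case (insert A \<A>)
    then obtain K where K: "compactin X K" "absolutely_convex s K" "\<forall>B\<in>\<A>. B \<subseteq> K" "K \<noteq> {}" by blast
    show ?case
    proof (cases "A = {}")
      case True
      then show ?thesis using K by auto
    next
      case False
      let ?K = "(\<lambda>(a, b). a + b) ` (A \<times> K)"
      have A: "compactin X A" "absolutely_convex s A" using insert.prems by auto
      have "0 \<in> A" "0 \<in> K" using A K False by (auto intro: absolutely_convex_zero[OF m])
      then have "A \<subseteq> ?K" "K \<subseteq> ?K" by force+
      then show ?thesis
        using compact_absolutely_convex_sum[OF X A K(1,2)] K False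
        by (intro exI[of _ ?K]) auto
    qed
  qed
  then show ?thesis using that by blast
qed

section \<open>Norm bounds for members of the epsilon-product\<close>

text \<open>Continuity at \<open>0\<close>: the preimage of the unit ball contains a basic
  neighbourhood, given by finitely many compact sets and a radius \<open>e\<close>. One
  \<open>K\<close> contains these sets, and homogeneity gives \<open>M = 1 / e\<close>.\<close>

lemma eps_maps_bounded_by_compact:
  assumes X: "lcHs s X" and E: "normed_space_over sE" and u: "u \<in> eps_maps s X sE"
  obtains K M where "compactin X K" "absolutely_convex s K"
    "\<And>y \<epsilon>. \<lbrakk>y \<in> dual s X; \<epsilon> > 0; \<forall>k\<in>K. norm (y k) \<le> \<epsilon>\<rbrakk> \<Longrightarrow> norm (u y) \<le> M * \<epsilon>"
proof -
  have lin: "linear_on (fscale times) sE (dual s X) u" using u by (simp add: eps_maps_def)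
  define W where "W = {y \<in> dual s X. u y \<in> ball 0 1}"
  have "openin (dual_kappa s X) W"
    using openin_continuous_map_preimage[of "dual_kappa s X" euclidean u "ball 0 1"] u
    by (simp add: eps_maps_def W_def dual_kappa_def)
  moreover have "0 \<in> W" by (simp add: W_def dual_map_zero[OF lin] dual_zero)
  ultimately have "\<exists>\<A> e. finite \<A> \<and> \<A> \<subseteq> {C. compactin X C \<and> absolutely_convex s C} \<and> e > 0 \<and>
      (\<forall>y\<in>dual s X. (\<forall>A\<in>\<A>. \<forall>k\<in>A. norm (y k - 0 k) \<le> e) \<longrightarrow> y \<in> W)"
    unfolding dual_kappa_def openin_unif_topology by (elim conjE) (drule bspec, assumption+)
  then obtain \<A> e where Ae: "finite \<A>" "\<A> \<subseteq> {C. compactin X C \<and> absolutely_convex s C}" "e > 0"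
    and W: "\<forall>y\<in>dual s X. (\<forall>A\<in>\<A>. \<forall>k\<in>A. norm (y k - 0 k) \<le> e) \<longrightarrow> y \<in> W"
    by (elim exE conjE)
  obtain K where K: "compactin X K" "absolutely_convex s K" "\<And>A. A \<in> \<A> \<Longrightarrow> A \<subseteq> K"
    using compact_absolutely_convex_upper_bound[OF X Ae(1)] Ae(2) by (metis (lifting) mem_Collect_eq subsetD)
  have "norm (u y) \<le> 1" if "y \<in> dual s X" "\<forall>k\<in>K. norm (y k) \<le> e" for y
  proof -
    have "norm (y k - 0 k) \<le> e" if "A \<in> \<A>" "k \<in> A" for A k
      using \<open>\<forall>k\<in>K. norm (y k) \<le> e\<close> K(3)[OF that(1)] that(2) by auto
    with W that(1) have "y \<in> W" by simp
    then show ?thesis by (simp add: W_def)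
  qed
  from norm_dual_map_le[OF lin E this \<open>e > 0\<close>] show ?thesis
    by (intro that[OF K(1,2), of "1 / e"]) auto
qed

text \<open>This replaces the bipolar theorem: the hypothesis \<open>dom\<close> says that \<open>y\<close> lies in the bipolar of
  the \<open>g j\<close>.\<close>

lemma eps_maps_bipolar_bound:
  fixes s :: "'k::real_or_complex \<Rightarrow> 'x::ab_group_add \<Rightarrow> 'x"
  assumes X: "lcHs s X" and E: "normed_space_over sE" and u: "u \<in> eps_maps s X sE"
    and y: "y \<in> dual s X" and g: "\<And>j. g j \<in> dual s X" "\<And>j. norm (u (g j)) \<le> C" and C: "C \<ge> 0"
    and dom: "\<And>k \<epsilon>. \<lbrakk>k \<in> topspace X; \<epsilon> > 0\<rbrakk> \<Longrightarrow> norm (y k) < \<epsilon> \<or> (\<exists>j. norm (y k) < \<epsilon> + norm (g j k))"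
  shows "norm (u y) \<le> C"
proof -
  have lin: "linear_on (fscale times) sE (dual s X) u" using u by (simp add: eps_maps_def)
  obtain K M where K: "compactin X K" "absolutely_convex s K"
    and M: "\<And>y \<epsilon>. \<lbrakk>y \<in> dual s X; \<epsilon> > 0; \<forall>k\<in>K. norm (y k) \<le> \<epsilon>\<rbrakk> \<Longrightarrow> norm (u y) \<le> M * \<epsilon>"
    using eps_maps_bounded_by_compact[OF X E u] by metis
  have le: "norm (u y) \<le> C + M * \<epsilon>" if \<epsilon>: "\<epsilon> > 0" for \<epsilon>
  proof -
    \<comment> \<open>The open sets on which \<open>y\<close> is below \<epsilon>, for index
      \<open>None\<close>, or below \<epsilon> plus the modulus of \<open>g j\<close>. By
      \<open>dom\<close> they cover \<open>K\<close>, so compactness leaves finitely many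
      \<open>g j\<close> to approximate with.\<close>
    define V where "V i = {k \<in> topspace X. norm (y k) - (case i of None \<Rightarrow> 0 | Some j \<Rightarrow> norm (g j k)) \<in> {..<\<epsilon>}}" for i
    have op: "openin X (V i)" for i
      unfolding V_def
      by (rule openin_continuous_map_preimage[where Y = euclideanreal]; cases i)
        (auto intro!: continuous_map_diff continuous_map_norm
          dual_continuous[OF y] dual_continuous[OF g(1)])
    have cov: "K \<subseteq> (\<Union>i\<in>UNIV. V i)"
    proof
      fix k assume "k \<in> K"
      then have k: "k \<in> topspace X" using compactin_subset_topspace[OF K(1)] by blast
      from dom[OF this \<epsilon>] have "k \<in> V None \<or> (\<exists>j. k \<in> V (Some j))"
        using k by (auto simp: V_def diff_less_eq)
      then show "k \<in> (\<Union>i\<in>UNIV. V i)" by blast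
    qed
    obtain F where F: "finite F" "K \<subseteq> (\<Union>i\<in>F. V i)"
      by (rule compactin_finite_subcover[OF K(1) op cov])
    define J where "J = Some -` F"
    have J: "finite J" unfolding J_def by (rule finite_vimageI[OF F(1)]) simp
    have "norm (y k) < \<epsilon> \<or> (\<exists>j\<in>J. norm (y k) < \<epsilon> + norm (g j k))" if "k \<in> K" for k
    proof -
      from that F(2) obtain i where "i \<in> F" "k \<in> V i" by blast
      then show ?thesis by (cases i) (auto simp: V_def J_def diff_less_eq)
    qed
    from functional_approximation[OF X K y J g(1) \<epsilon> this] obtain c
      where c: "(\<Sum>j\<in>J. norm (c j)) \<le> 1" "\<forall>k\<in>K. norm (y k - (\<Sum>j\<in>J. c j * g j k)) \<le> \<epsilon>"
      by blast
    define l where "l = (\<Sum>j\<in>J. fscale times (c j) (g j))"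
    have l: "l \<in> dual s X" unfolding l_def by (intro dual_sum dual_fscale g)
    have "norm (u l) \<le> (\<Sum>j\<in>J. norm (c j) * norm (u (g j)))"
      unfolding l_def by (rule norm_dual_map_sum_le[OF lin E g(1)])
    also have "\<dots> \<le> (\<Sum>j\<in>J. norm (c j)) * C"
      unfolding sum_distrib_right by (intro sum_mono mult_left_mono g) auto
    also have "\<dots> \<le> 1 * C" using c(1) C by (rule mult_right_mono)
    finally have "norm (u l) \<le> C" by simp
    moreover have "norm (u (y - l)) \<le> M * \<epsilon>"
      using c(2) by (intro M dual_diff y l \<epsilon>) (simp add: l_def sum_fscale_apply)
    moreover have "norm (u y) \<le> norm (u l) + norm (u y - u l)" by norm
    ultimately show ?thesis by (simp add: dual_map_diff[OF lin y l])
  qed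
  \<comment> \<open>\<open>K\<close> and \<open>M\<close> depend on \<open>u\<close> alone, so the
    error \<open>M * \<epsilon>\<close> vanishes as \<epsilon> tends to \<open>0\<close>.\<close>
  have "((\<lambda>\<epsilon>. C + M * \<epsilon>) \<longlongrightarrow> C + M * 0) (at_right 0)"
    by (intro tendsto_intros)
  moreover have "eventually (\<lambda>\<epsilon>. norm (u y) \<le> C + M * \<epsilon>) (at_right 0)"
    by (rule eventually_mono[OF eventually_at_right_less]) (rule le)
  ultimately have "norm (u y) \<le> C + M * 0"
    by (rule tendsto_lowerbound) simp
  then show ?thesis by simp
qed

section \<open>Uniform approximation over equicontinuous sets\<close>

text \<open>Neighbourhoods of \<open>0\<close> are absorbing, because \<open>t\<close> times
  \<open>k\<close> tends to \<open>0\<close> with \<open>t\<close>.\<close>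

lemma lcHs_scaled_in_neighbourhood:
  assumes X: "lcHs s X" and V: "openin X V" "0 \<in> V" and k: "k \<in> topspace X"
  obtains n :: nat where "n > 0" "s (inverse (of_nat n)) k \<in> V"
proof -
  have "continuous_map euclidean X (\<lambda>t. s t k)"
    using continuous_map_compose[OF _ lcHs_continuous_scale[OF X], of euclidean "\<lambda>t. (t, k)"] k
    by (simp add: o_def continuous_map_pairedI)
  from openin_continuous_map_preimage[OF this V(1)] have "open {t. s t k \<in> V}" by simp
  moreover have "s 0 k \<in> V"
    using V(2) module.scale_zero_left[OF lcHs_module[OF X]] by simp
  ultimately have "eventually (\<lambda>t. s t k \<in> V) (nhds 0)"
    by (auto simp: eventually_nhds)
  then have "eventually (\<lambda>n. s (inverse (of_nat n)) k \<in> V) sequentially"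
    using lim_inverse_n by (rule eventually_compose_filterlim)
  then obtain N where "\<forall>n\<ge>N. s (inverse (of_nat n)) k \<in> V"
    by (auto simp: eventually_sequentially)
  then show ?thesis by (intro that[of "Suc N"]) (auto simp del: of_nat_Suc)
qed

text \<open>The finite set and the coefficient bound are uniform over the equicontinuous set, which makes
  Arzela-Ascoli unnecessary below.\<close>

lemma equicontinuous_approximation:
  fixes s :: "'k::real_or_complex \<Rightarrow> 'x::ab_group_add \<Rightarrow> 'x" and U :: "'w set"
  assumes X: "lcHs s X" and K: "compactin X K" "absolutely_convex s K"
    and H: "equicontinuous s X H" and g: "\<And>x. x \<in> U \<Longrightarrow> g x \<in> dual s X"
    and sep: "\<And>k. \<lbrakk>k \<in> K; \<forall>x\<in>U. g x k = 0\<rbrakk> \<Longrightarrow> k = 0" and \<epsilon>: "\<epsilon> > 0"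
  shows "\<exists>F M. finite F \<and> F \<subseteq> U \<and> (\<forall>y\<in>H. \<exists>c. (\<Sum>x\<in>F. norm (c x)) \<le> M \<and>
    (\<forall>k\<in>K. norm (y k - (\<Sum>x\<in>F. c x * g x k)) \<le> \<epsilon>))"
proof -
  have HD: "H \<subseteq> dual s X" using H by (simp add: equicontinuous_def)
  have "\<epsilon> / 2 > 0" using \<epsilon> by simp
  then obtain V where V: "openin X V" "0 \<in> V" "\<And>y k. \<lbrakk>y \<in> H; k \<in> V\<rbrakk> \<Longrightarrow> norm (y k) \<le> \<epsilon> / 2"
    using H unfolding equicontinuous_def by metis
  \<comment> \<open>On \<open>V\<close> all of \<open>H\<close> is at most
    \<open>\<epsilon> / 2\<close>. A point \<open>k\<close> of the set indexed by
    \<open>(x, n, m)\<close> lies in \<open>n\<close> times \<open>V\<close>, so every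
    \<open>y\<close> in \<open>H\<close> satisfies
    \<open>norm (y k) \<le> n * \<epsilon> / 2\<close>, which is below
    \<open>m * norm (g x k)\<close>. The choice of cover is therefore independent of
    \<open>y\<close>.\<close>
  define O' where "O' i = (case i of None \<Rightarrow> V
      | Some (x, n, m) \<Rightarrow> {k \<in> topspace X. s (inverse (of_nat n)) k \<in> V} \<inter>
          {k \<in> topspace X. of_nat m * norm (g x k) \<in> {of_nat n * \<epsilon><..}})"
    for i :: "('w \<times> nat \<times> nat) option"
  define A :: "(('w \<times> nat \<times> nat) option) set" where "A = insert None (Some ` (U \<times> {0<..} \<times> UNIV))"
  have scale: "continuous_map X X (s c)" for c
    using continuous_map_compose[OF _ lcHs_continuous_scale[OF X], of X "\<lambda>k. (c, k)"]
    by (simp add: o_def continuous_map_pairedI)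
  have op: "openin X (O' i)" if "i \<in> A" for i
  proof -
    have "openin X {k \<in> topspace X. of_nat m * norm (g x k) \<in> {r<..}}" if "x \<in> U" for m :: nat and x and r :: real
      by (rule openin_continuous_map_preimage[where Y = euclideanreal])
        (auto intro!: continuous_map_real_mult continuous_map_norm dual_continuous[OF g[OF that]])
    then show ?thesis
      using that V(1) openin_continuous_map_preimage[OF scale V(1)] by (auto simp: O'_def A_def intro!: openin_Int)
  qed
  have cov: "K \<subseteq> (\<Union>i\<in>A. O' i)"
  proof
    fix k assume kK: "k \<in> K"
    then have k: "k \<in> topspace X" using compactin_subset_topspace[OF K(1)] by blast
    show "k \<in> (\<Union>i\<in>A. O' i)"
    proof (cases "k = 0")
      case True
      then show ?thesis using V(2) by (auto simp: A_def O'_def)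
    next
      case False
      then obtain x where x: "x \<in> U" "g x k \<noteq> 0" using sep[OF kK] by blast
      obtain n :: nat where n: "n > 0" "s (inverse (of_nat n)) k \<in> V"
        using lcHs_scaled_in_neighbourhood[OF X V(1,2) k] by blast
      obtain m :: nat where "of_nat n * \<epsilon> < of_nat m * norm (g x k)"
        using x(2) reals_Archimedean3[of "norm (g x k)"] by auto
      then have "k \<in> O' (Some (x, n, m))" using n k by (auto simp: O'_def)
      then show ?thesis using x n by (force simp: A_def)
    qed
  qed
  obtain G where G: "finite G" "G \<subseteq> A" "K \<subseteq> (\<Union>i\<in>G. O' i)"
    by (rule compactin_finite_subcover[OF K(1) op cov])
  define P where "P = Some -` G"
  have P: "finite P" unfolding P_def by (rule finite_vimageI[OF G(1)]) simp
  have PA: "P \<subseteq> U \<times> {0<..} \<times> UNIV" using G(2) by (auto simp: P_def A_def)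
  define F where "F = fst ` P"
  \<comment> \<open>The sum of the multipliers \<open>m\<close> in the finite subcover dominates
    each of them, so a single factor serves every \<open>x\<close> in \<open>F\<close>.\<close>
  define M where "M = (\<Sum>p\<in>P. snd (snd p))"
  have F: "finite F" "F \<subseteq> U" using P PA by (auto simp: F_def)
  show ?thesis
  proof (intro exI[of _ F] exI[of _ "real M"] conjI ballI F)
    fix y assume yH: "y \<in> H"
    then have y: "y \<in> dual s X" using HD by blast
    have dom: "norm (y k) < \<epsilon> \<or> (\<exists>x\<in>F. norm (y k) < \<epsilon> + norm (fscale times (of_nat M) (g x) k))" if "k \<in> K" for k
    proof -
      from that have k: "k \<in> topspace X" using compactin_subset_topspace[OF K(1)] by blast
      from that G(3) obtain i where i: "i \<in> G" "k \<in> O' i" by blast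
      show ?thesis
      proof (cases i)
        case None
        then have "norm (y k) \<le> \<epsilon> / 2" using i V(3)[OF yH] by (auto simp: O'_def)
        with \<epsilon> show ?thesis by auto
      next
        case (Some p)
        obtain x n m where p: "p = (x, n, m)" by (metis prod.exhaust)
        with Some i have xP: "(x, n, m) \<in> P" by (simp add: P_def)
        with PA have n: "n > 0" by auto
        have kV: "s (inverse (of_nat n)) k \<in> V" and lt: "of_nat n * \<epsilon> < of_nat m * norm (g x k)"
          using i by (auto simp: Some p O'_def)
        have "norm (y (s (inverse (of_nat n)) k)) \<le> \<epsilon> / 2" by (rule V(3)[OF yH kV])
        then have "norm (y k) \<le> of_nat n * \<epsilon> / 2"
          using n by (simp add: dual_scale_arg[OF y k] norm_mult norm_inverse norm_divide field_simps)
        also have "\<dots> \<le> of_nat n * \<epsilon>" using \<epsilon> by simp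
        also have "\<dots> < of_nat m * norm (g x k)" by (rule lt)
        also have "\<dots> \<le> of_nat M * norm (g x k)"
          unfolding M_def using member_le_sum[OF xP _ P, of "\<lambda>p. snd (snd p)"]
          by (intro mult_right_mono) (auto simp del: of_nat_sum)
        also have "\<dots> = norm (fscale times (of_nat M) (g x) k)" by (simp add: fscale_def norm_mult)
        finally have "norm (y k) < \<epsilon> + norm (fscale times (of_nat M) (g x) k)" using \<epsilon> by simp
        moreover have "x \<in> F" using xP by (force simp: F_def)
        ultimately show ?thesis by blast
      qed
    qed
    have "fscale times (of_nat M) (g x) \<in> dual s X" if "x \<in> F" for x
      using that F(2) by (intro dual_fscale g) auto
    \<comment> \<open>Applied to the functionals \<open>g x\<close> multiplied by \<open>M\<close>;
      a coefficient sum of at most \<open>1\<close> for these is one of at most \<open>M\<close> for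
      the \<open>g x\<close>.\<close>
    from functional_approximation[OF X K y F(1) this \<epsilon> dom] obtain c
      where c: "(\<Sum>x\<in>F. norm (c x)) \<le> 1"
        "\<forall>k\<in>K. norm (y k - (\<Sum>x\<in>F. c x * fscale times (of_nat M) (g x) k)) \<le> \<epsilon>" by blast
    have "(\<Sum>x\<in>F. norm (c x * of_nat M)) \<le> of_nat M"
      using mult_right_mono[OF c(1), of "of_nat M"] by (simp add: norm_mult sum_distrib_right)
    with c(2) show "\<exists>c. (\<Sum>x\<in>F. norm (c x)) \<le> of_nat M \<and> (\<forall>k\<in>K. norm (y k - (\<Sum>x\<in>F. c x * g x k)) \<le> \<epsilon>)"
      by (intro exI[of _ "\<lambda>x. c x * of_nat M"]) (simp add: fscale_def mult.assoc)
  qed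
qed

section \<open>Limits of nets in the epsilon-product\<close>

text \<open>Lets pointwise limits be read off from a Cauchy estimate over equicontinuous
  sets.\<close>

lemma dual_singleton_equicontinuous:
  assumes X: "lcHs s X" and y: "y \<in> dual s X"
  shows "equicontinuous s X {y}"
  unfolding equicontinuous_def
proof (intro conjI allI impI)
  fix e :: real assume e: "e > 0"
  have "y 0 = 0"
    using dual_scale_arg[OF y lcHs_zero[OF X], of 0] module.scale_zero_left[OF lcHs_module[OF X]] by simp
  moreover have "openin X {k \<in> topspace X. y k \<in> ball 0 e}"
    by (rule openin_continuous_map_preimage[OF dual_continuous[OF y]]) simp
  ultimately show "\<exists>V. openin X V \<and> 0 \<in> V \<and> (\<forall>\<phi>\<in>{y}. \<forall>x\<in>V. norm (\<phi> x) \<le> e)"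
    using e lcHs_zero[OF X] by (intro exI[of _ "{k \<in> topspace X. y k \<in> ball 0 e}"]) auto
qed (use y in simp)

text \<open>Allows multiplication by a scalar of \<open>'k\<close> to pass through limits, as
  linearity of a limit map requires.\<close>

lemma bounded_linear_scalar_mult:
  assumes "normed_space_over sE"
  shows "bounded_linear (sE c)"
proof (rule bounded_linear_intro[of _ "norm c"])
  have m: "module sE" using assms by (simp add: normed_space_over_def module_iff_vector_space)
  show "sE c (x + y) = sE c x + sE c y" for x y
    by (rule module.scale_right_distrib[OF m])
  show "sE c (r *\<^sub>R x) = r *\<^sub>R sE c x" for r x
    using assms module.scale_left_commute[OF m] unfolding normed_space_over_def by metis
  show "norm (sE c x) \<le> norm x * norm c" for x
    using assms by (simp add: normed_space_over_def mult.commute)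
qed

text \<open>On an equicontinuous set, functionals are approximated over \<open>K\<close> by
  combinations of finitely many \<open>g x\<close> with bounded coefficients. The bound on the polar
  of \<open>K\<close> controls the error uniformly in \<open>i\<close>, so convergence at the
  \<open>g x\<close> makes the net uniformly Cauchy. The same bound survives in the limit and gives
  its continuity. The condition on \<open>u\<close> is required only eventually, since a net is
  unconstrained off its index set.\<close>

lemma eps_maps_net_convergent:
  fixes s :: "'k::real_or_complex \<Rightarrow> 'x::ab_group_add \<Rightarrow> 'x"
    and sE :: "'k \<Rightarrow> 'e::banach \<Rightarrow> 'e" and \<F> :: "'i filter"
  assumes X: "lcHs s X" and E: "normed_space_over sE"
    and K: "compactin X K" "absolutely_convex s K"
    and g: "\<And>x. x \<in> U \<Longrightarrow> g x \<in> dual s X"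
    and sep: "\<And>k. \<lbrakk>k \<in> K; \<forall>x\<in>U. g x k = 0\<rbrakk> \<Longrightarrow> k = 0"
    and \<F>: "\<F> \<noteq> bot"
    and u: "eventually (\<lambda>i. u i \<in> eps_maps s X sE \<and> (\<forall>y\<in>polar_in_dual s X K. norm (u i y) \<le> C)) \<F>"
    and lim: "\<And>x. x \<in> U \<Longrightarrow> \<exists>l. ((\<lambda>i. u i (g x)) \<longlongrightarrow> l) \<F>"
  obtains v where "v \<in> eps_maps s X sE" "\<And>y. y \<in> polar_in_dual s X K \<Longrightarrow> norm (v y) \<le> C"
    "limitin (eps_product s X sE) u v \<F>"
proof -
  define G where "G i \<longleftrightarrow> u i \<in> eps_maps s X sE \<and> (\<forall>y\<in>polar_in_dual s X K. norm (u i y) \<le> C)" for i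
  have evG: "eventually G \<F>" by (rule eventually_mono[OF u]) (simp add: G_def)
  have lin: "linear_on (fscale times) sE (dual s X) (u i)" if "G i" for i
    using that by (simp add: G_def eps_maps_def)
  have bound: "norm (u i y) \<le> C * \<epsilon>" if "G i" "y \<in> dual s X" "\<forall>k\<in>K. norm (y k) \<le> \<epsilon>" "\<epsilon> > 0" for i y \<epsilon>
    using norm_dual_map_le[OF lin[OF that(1)] E, of K 1 C y \<epsilon>] that
    by (auto simp: G_def polar_in_dual_def)
  \<comment> \<open>The zero functional lies in the polar, so \<open>C\<close> bounds a norm; an
    index satisfying \<open>G\<close> exists because the filter is proper.\<close>
  have C: "C \<ge> 0"
  proof -
    obtain i where "G i" using evG \<F> by (auto dest: eventually_happens)
    then show ?thesis
      using dual_zero[of s X] unfolding G_def polar_in_dual_def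
      by (fastforce intro: order_trans[OF norm_ge_zero])
  qed
  have cauchy: "\<exists>P. eventually P \<F> \<and> (\<forall>i j. P i \<and> P j \<longrightarrow> (\<forall>y\<in>H. dist (u i y) (u j y) < e))"
    if H: "equicontinuous s X H" and e: "e > 0" for H e
  proof -
    \<comment> \<open>The final error is \<open>2 * (C * \<delta>)\<close> from replacing
      \<open>y\<close> by its approximant and \<open>2 * (M' * \<eta>)\<close> from the finitely
      many \<open>g x\<close>, each below half of \<open>e\<close>. Adding \<open>1\<close> in the
      denominators allows \<open>C = 0\<close> and \<open>M' = 0\<close>.\<close>
    define \<delta> where "\<delta> = e / (4 * (C + 1))"
    have \<delta>: "\<delta> > 0" "4 * (C * \<delta>) < e" using e C by (auto simp: \<delta>_def field_simps)
    have "\<exists>F M. finite F \<and> F \<subseteq> U \<and> (\<forall>y\<in>H. \<exists>c. (\<Sum>x\<in>F. norm (c x)) \<le> M \<and>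
        (\<forall>k\<in>K. norm (y k - (\<Sum>x\<in>F. c x * g x k)) \<le> \<delta>))"
      using \<delta>(1) by (intro equicontinuous_approximation[OF X K H] g sep)
    then obtain F M where F: "finite F" "F \<subseteq> U" and approx:
      "\<forall>y\<in>H. \<exists>c. (\<Sum>x\<in>F. norm (c x)) \<le> M \<and> (\<forall>k\<in>K. norm (y k - (\<Sum>x\<in>F. c x * g x k)) \<le> \<delta>)"
      by (elim exE conjE)
    \<comment> \<open>For empty \<open>H\<close> the approximation statement leaves \<open>M\<close>
      arbitrary, possibly negative.\<close>
    define M' where "M' = max M 0"
    define \<eta> where "\<eta> = e / (4 * (M' + 1))"
    have M': "M' \<ge> 0" "M \<le> M'" by (auto simp: M'_def)
    have \<eta>: "\<eta> > 0" "4 * (M' * \<eta>) < e" using e M' by (auto simp: \<eta>_def field_simps)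
    obtain l where l: "\<And>x. x \<in> U \<Longrightarrow> ((\<lambda>i. u i (g x)) \<longlongrightarrow> l x) \<F>" using lim by metis
    define P where "P i \<longleftrightarrow> G i \<and> (\<forall>x\<in>F. dist (u i (g x)) (l x) < \<eta>)" for i
    have "eventually P \<F>"
      unfolding P_def using evG F l \<eta>(1)
      by (intro eventually_conj eventually_ball_finite ballI tendstoD) auto
    moreover have "dist (u i y) (u j y) < e" if P: "P i" "P j" and yH: "y \<in> H" for i j y
    proof -
      have y: "y \<in> dual s X" using H yH by (auto simp: equicontinuous_def)
      have gF: "\<And>x. x \<in> F \<Longrightarrow> g x \<in> dual s X" using F(2) g by blast
      from bspec[OF approx yH] obtain c where c: "(\<Sum>x\<in>F. norm (c x)) \<le> M"
        "\<forall>k\<in>K. norm (y k - (\<Sum>x\<in>F. c x * g x k)) \<le> \<delta>" by blast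
      define z where "z = (\<Sum>x\<in>F. fscale times (c x) (g x))"
      have z: "z \<in> dual s X" unfolding z_def by (intro dual_sum dual_fscale gF)
      have small: "norm (u i (y - z)) \<le> C * \<delta>" if "P i" for i
        using that c(2) by (intro bound dual_diff y z \<delta>(1)) (auto simp: P_def z_def sum_fscale_apply)
      \<comment> \<open>The difference of two members of the net is linear, so the estimate for
        finite combinations applies to it directly.\<close>
      have linD: "linear_on (fscale times) sE (dual s X) (\<lambda>y. u i y - u j y)"
      proof -
        have m: "module sE" using E by (simp add: normed_space_over_def module_iff_vector_space)
        have "linear_on (fscale times) sE (dual s X) (u i)" "linear_on (fscale times) sE (dual s X) (u j)"
          using P lin by (auto simp: P_def)
        then show ?thesis
          using module.scale_right_diff_distrib[OF m] unfolding linear_on_def by simp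
      qed
      have "norm (u i z - u j z) \<le> (\<Sum>x\<in>F. norm (c x) * norm (u i (g x) - u j (g x)))"
        unfolding z_def by (rule norm_dual_map_sum_le[OF linD E gF])
      also have "\<dots> \<le> (\<Sum>x\<in>F. norm (c x) * (2 * \<eta>))"
      proof (intro sum_mono mult_left_mono)
        fix x assume "x \<in> F"
        then have "dist (u i (g x)) (l x) < \<eta>" "dist (u j (g x)) (l x) < \<eta>" using P by (auto simp: P_def)
        then have "dist (u i (g x)) (u j (g x)) < \<eta> + \<eta>" by metric
        then show "norm (u i (g x) - u j (g x)) \<le> 2 * \<eta>" by (simp add: dist_norm)
      qed auto
      also have "\<dots> \<le> M' * (2 * \<eta>)"
        unfolding sum_distrib_right[symmetric] using c(1) M' \<eta> by (intro mult_right_mono) auto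
      finally have "norm (u i z - u j z) \<le> 2 * (M' * \<eta>)" by simp
      moreover have "u i (y - z) = u i y - u i z" "u j (y - z) = u j y - u j z"
        using P by (auto simp: P_def intro!: dual_map_diff[OF lin y z])
      moreover have "norm (u i y - u j y) \<le> norm (u i y - u i z) + norm (u j y - u j z) + norm (u i z - u j z)"
        by norm
      ultimately have "norm (u i y - u j y) \<le> 2 * (C * \<delta>) + 2 * (M' * \<eta>)"
        using small[OF P(1)] small[OF P(2)] by simp
      also have "\<dots> < e" using \<delta>(2) \<eta>(2) by simp
      finally show ?thesis by (simp add: dist_norm)
    qed
    ultimately show ?thesis by blast
  qed
  have "\<exists>l. ((\<lambda>i. u i y) \<longlongrightarrow> l) \<F>" if y: "y \<in> dual s X" for y
  proof -
    \<comment> \<open>The estimate for the singleton of \<open>y\<close> makes the image filter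
      Cauchy, and \<open>'e\<close> is complete.\<close>
    have "cauchy_filter (filtermap (\<lambda>i. u i y) \<F>)"
      unfolding cauchy_filter_metric_filtermap
      using cauchy[OF dual_singleton_equicontinuous[OF X y]] by simp
    from cauchy_filter_complete_converges[OF this complete_UNIV]
    obtain l where "filtermap (\<lambda>i. u i y) \<F> \<le> nhds l"
      using \<F> by (auto simp: filtermap_bot_iff)
    then show ?thesis by (auto simp: filterlim_def)
  qed
  then obtain l where l: "\<And>y. y \<in> dual s X \<Longrightarrow> ((\<lambda>i. u i y) \<longlongrightarrow> l y) \<F>" by metis
  \<comment> \<open>Membership in \<open>eps_maps\<close> demands the value \<open>0\<close> outside
    the dual.\<close>
  define v where "v = zero_ext (dual s X) l"
  have v: "((\<lambda>i. u i y) \<longlongrightarrow> v y) \<F>" if "y \<in> dual s X" for y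
    using l[OF that] that by (simp add: v_def zero_ext_def)
  have vlin: "linear_on (fscale times) sE (dual s X) v"
    unfolding linear_on_def
  proof (intro conjI ballI allI)
    fix y z assume yz: "y \<in> dual s X" "z \<in> dual s X"
    have "((\<lambda>i. u i (y + z)) \<longlongrightarrow> v y + v z) \<F>"
      by (rule Lim_transform_eventually[OF tendsto_add[OF v[OF yz(1)] v[OF yz(2)]]], rule eventually_mono[OF evG])
        (use lin yz in \<open>simp add: linear_on_def\<close>)
    with v[OF dual_add[OF yz]] show "v (y + z) = v y + v z" using \<F> by (intro tendsto_unique)
  next
    fix c y assume y: "y \<in> dual s X"
    have "((\<lambda>i. u i (fscale times c y)) \<longlongrightarrow> sE c (v y)) \<F>"
      by (rule Lim_transform_eventually[OF bounded_linear.tendsto[OF bounded_linear_scalar_mult[OF E] v[OF y]]],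
          rule eventually_mono[OF evG])
        (use lin y in \<open>simp add: linear_on_def\<close>)
    with v[OF dual_fscale[OF y]] show "v (fscale times c y) = sE c (v y)" using \<F> by (intro tendsto_unique)
  qed
  have vC: "norm (v y) \<le> C" if "y \<in> polar_in_dual s X K" for y
  proof (rule tendsto_upperbound[OF tendsto_norm[OF v] _ \<F>])
    show "y \<in> dual s X" using that by (simp add: polar_in_dual_def)
    show "eventually (\<lambda>i. norm (u i y) \<le> C) \<F>"
      by (rule eventually_mono[OF evG]) (use that in \<open>simp add: G_def\<close>)
  qed
  have vbound: "norm (v y) \<le> C * \<epsilon>" if "y \<in> dual s X" "\<forall>k\<in>K. norm (y k) \<le> \<epsilon>" "\<epsilon> > 0" for y \<epsilon>
    using norm_dual_map_le[OF vlin E, of K 1 C y \<epsilon>] that vC by (auto simp: polar_in_dual_def)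
  \<comment> \<open>By \<open>vbound\<close> and linearity, uniform closeness on the single set
    \<open>K\<close> controls \<open>v\<close> around every point; \<open>K\<close> is one of the
    sets defining \<open>dual_kappa\<close>.\<close>
  have "continuous_map (dual_kappa s X) euclidean v"
    unfolding continuous_map_def
  proof (intro conjI allI impI)
    fix W :: "'e set" assume "openin euclidean W"
    then have W: "open W" by simp
    have "\<exists>\<A> e. finite \<A> \<and> \<A> \<subseteq> {C. compactin X C \<and> absolutely_convex s C} \<and> e > 0 \<and>
        (\<forall>z\<in>dual s X. (\<forall>A\<in>\<A>. \<forall>k\<in>A. norm (z k - y k) \<le> e) \<longrightarrow> z \<in> {y \<in> dual s X. v y \<in> W})"
      if y: "y \<in> dual s X" "v y \<in> W" for y
    proof -
      obtain r where r: "r > 0" "ball (v y) r \<subseteq> W" using W y(2) open_contains_ball by blast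
      define e where "e = r / (C + 1)"
      have e: "e > 0" "C * e < r" using r(1) C by (auto simp: e_def field_simps)
      have "v z \<in> W" if z: "z \<in> dual s X" "\<forall>k\<in>K. norm (z k - y k) \<le> e" for z
      proof -
        have "norm (v (z - y)) \<le> C * e" using z e(1) by (intro vbound dual_diff y) auto
        then have "dist (v y) (v z) < r"
          using e(2) by (simp add: dual_map_diff[OF vlin z(1) y(1)] dist_norm norm_minus_commute)
        then show ?thesis using r(2) by auto
      qed
      then show ?thesis using K e(1) by (intro exI[of _ "{K}"] exI[of _ e]) auto
    qed
    then show "openin (dual_kappa s X) {y \<in> topspace (dual_kappa s X). v y \<in> W}"
      unfolding dual_kappa_def openin_unif_topology topspace_unif_topology by blast
  qed simp
  then have veps: "v \<in> eps_maps s X sE"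
    using vlin by (simp add: eps_maps_def v_def zero_ext_def)
  \<comment> \<open>Fix \<open>i\<close> and let \<open>j\<close> run to the limit in the Cauchy
    estimate; the strict inequality becomes a non-strict one.\<close>
  have unif: "eventually (\<lambda>i. \<forall>y\<in>H. norm (u i y - v y) \<le> e) \<F>"
    if H: "equicontinuous s X H" and e: "e > 0" for H e
  proof -
    obtain P where P: "eventually P \<F>" "\<And>i j y. \<lbrakk>P i; P j; y \<in> H\<rbrakk> \<Longrightarrow> dist (u i y) (u j y) < e"
      using cauchy[OF H e] by blast
    show ?thesis
    proof (rule eventually_mono[OF P(1)], intro ballI)
      fix i y assume i: "P i" and y: "y \<in> H"
      then have "y \<in> dual s X" using H by (auto simp: equicontinuous_def)
      then have "((\<lambda>j. norm (u i y - u j y)) \<longlongrightarrow> norm (u i y - v y)) \<F>"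
        by (intro tendsto_intros v)
      then show "norm (u i y - v y) \<le> e"
      proof (rule tendsto_upperbound[OF _ _ \<F>])
        show "eventually (\<lambda>j. norm (u i y - u j y) \<le> e) \<F>"
          by (rule eventually_mono[OF P(1)]) (use P(2)[OF i _ y] in \<open>simp add: dist_norm less_imp_le\<close>)
      qed
    qed
  qed
  have "limitin (eps_product s X sE) u v \<F>"
    unfolding limitin_def
  proof (intro conjI allI impI)
    show "v \<in> topspace (eps_product s X sE)" using veps by (simp add: eps_product_def)
    fix W assume W: "openin (eps_product s X sE) W \<and> v \<in> W"
    then have "\<exists>\<A> e. finite \<A> \<and> \<A> \<subseteq> {H. equicontinuous s X H} \<and> e > 0 \<and>
        (\<forall>w\<in>eps_maps s X sE. (\<forall>A\<in>\<A>. \<forall>y\<in>A. norm (w y - v y) \<le> e) \<longrightarrow> w \<in> W)"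
      unfolding eps_product_def openin_unif_topology by (elim conjE) (drule bspec, assumption+)
    then obtain \<A> e where \<A>: "finite \<A>" "\<A> \<subseteq> {H. equicontinuous s X H}" "e > 0"
      and *: "\<forall>w\<in>eps_maps s X sE. (\<forall>A\<in>\<A>. \<forall>y\<in>A. norm (w y - v y) \<le> e) \<longrightarrow> w \<in> W"
      by (elim exE conjE)
    have "eventually (\<lambda>i. \<forall>A\<in>\<A>. \<forall>y\<in>A. norm (u i y - v y) \<le> e) \<F>"
      using \<A> by (intro eventually_ball_finite ballI unif) auto
    with evG show "eventually (\<lambda>i. u i \<in> W) \<F>"
      by eventually_elim (use * in \<open>simp add: G_def\<close>)
  qed
  with veps vC that show ?thesis by blast
qed

section \<open>Convergence in the weighted function space\<close>

theorem corollary5p4p2: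
  fixes sE :: "'k::real_or_complex \<Rightarrow> 'e::banach \<Rightarrow> 'e"
    and \<nu> :: "'w \<Rightarrow> real"
    and AP dom_T :: "('a \<Rightarrow> 'k) set" and T :: "('a \<Rightarrow> 'k) \<Rightarrow> ('w \<Rightarrow> 'k)"
    and AP_E dom_TE :: "('a \<Rightarrow> 'e) set" and TE :: "('a \<Rightarrow> 'e) \<Rightarrow> ('w \<Rightarrow> 'e)"
    and X :: "('a \<Rightarrow> 'k) topology" and XE :: "('a \<Rightarrow> 'e) topology"
    and U :: "'w set"
    and I :: "'i set" and le :: "'i \<Rightarrow> 'i \<Rightarrow> bool" and f :: "'i \<Rightarrow> ('a \<Rightarrow> 'e)"
  assumes E: "normed_space_over sE" "\<exists>y::'e. y \<noteq> 0"
    and \<nu>: "\<And>x. \<nu> x > 0"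
    and AP: "module.subspace (fscale times) AP" "module.subspace (fscale sE) AP_E"
    and dom: "module.subspace (fscale times) dom_T" "module.subspace (fscale sE) dom_TE"
    and T: "linear_on (fscale times) (fscale times) dom_T T"
    and TE: "linear_on (fscale sE) (fscale sE) dom_TE TE"
    and X: "topspace X = AP \<inter> dom_T" "lcHs (fscale times) X"
    and XE: "topspace XE = AP_E \<inter> dom_TE" "lcHs (fscale sE) XE"
    and delta: "\<And>x. delta (topspace X) x \<in> dual (fscale times) X"
    and nontrivial: "topspace X \<noteq> {0}" "topspace XE \<noteq> {0}" "Fnu \<nu> T X \<noteq> {0}" "Fnu \<nu> TE XE \<noteq> {0}"
    and compatible: "eps_into_compatible X sE XE"
    and gen: "generator \<nu> T X TE XE"
    and strong: "strong T X sE TE XE"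
    and consistent: "consistent T X sE TE XE"
    and Fnu_banach: "banach_space_on (fscale times) (Fnu \<nu> T X) (nu_norm \<nu> T)"
    and ball_compact: "compactin X (Fnu_ball \<nu> T X)"
    and U: "set_of_uniqueness \<nu> T X U"
    and net: "directed_on I le"
    and f_mem: "\<And>\<iota>. \<iota> \<in> I \<Longrightarrow> f \<iota> \<in> F_eps_nu \<nu> T X sE"
    and f_bounded: "\<exists>C. \<forall>\<iota>\<in>I. f \<iota> \<in> Fnu \<nu> TE XE \<and> nu_norm \<nu> TE (f \<iota>) \<le> C"
    and f_lim: "\<And>x. x \<in> U \<Longrightarrow> \<exists>l. ((\<lambda>\<iota>. TE (f \<iota>) x) \<longlongrightarrow> l) (net_filter I le)"
  shows "\<exists>g \<in> F_eps_nu \<nu> T X sE. limitin XE f g (net_filter I le)"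
proof -
  let ?s = "fscale times :: 'k \<Rightarrow> ('a \<Rightarrow> 'k) \<Rightarrow> 'a \<Rightarrow> 'k"
  let ?B = "Fnu_ball \<nu> T X" and ?\<F> = "net_filter I le"
  let ?T = "T_at T (topspace X)"
  have Teq: "?T x k = T k x" if "k \<in> topspace X" for k x
    using that by (simp add: T_at_def zero_ext_def)
  have T_add: "T (k + l) x = T k x + T l x" if "k \<in> topspace X" "l \<in> topspace X" for k l x
    using that T X(1) by (simp add: linear_on_def)
  have T_scale: "T (?s c k) x = c * T k x" if "k \<in> topspace X" for k c x
    using that T X(1) by (simp add: linear_on_def fscale_def[of times c "T k"])
  \<comment> \<open>Finiteness of the supremum and its bound by \<open>1\<close> merge into a
    condition at each \<open>x\<close>, which suits absolute convexity and scaling.\<close>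
  have B: "k \<in> ?B \<longleftrightarrow> k \<in> topspace X \<and> (\<forall>x. norm (T k x) * \<nu> x \<le> 1)" for k
  proof
    assume "k \<in> ?B"
    then have k: "k \<in> topspace X" "bdd_above (range (\<lambda>x. norm (T k x) * \<nu> x))" "nu_norm \<nu> T k \<le> 1"
      by (auto simp: Fnu_ball_def Fnu_def)
    have "norm (T k x) * \<nu> x \<le> nu_norm \<nu> T k" for x
      unfolding nu_norm_def by (rule cSUP_upper[OF _ k(2)]) simp
    with k show "k \<in> topspace X \<and> (\<forall>x. norm (T k x) * \<nu> x \<le> 1)" by (meson order_trans)
  next
    assume "k \<in> topspace X \<and> (\<forall>x. norm (T k x) * \<nu> x \<le> 1)"
    then show "k \<in> ?B"
      by (auto simp: Fnu_ball_def Fnu_def nu_norm_def intro!: cSUP_least bdd_aboveI)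
  qed
  have B_acx: "absolutely_convex ?s ?B"
    unfolding absolutely_convex_def
  proof (intro ballI allI impI)
    fix k l and c d :: 'k
    assume k: "k \<in> ?B" and l: "l \<in> ?B" and cd: "norm c + norm d \<le> 1"
    have kl: "k \<in> topspace X" "l \<in> topspace X" using k l by (auto simp: B)
    have "norm (T (?s c k + ?s d l) x) * \<nu> x \<le> 1" for x
    proof -
      have "norm (T (?s c k + ?s d l) x) * \<nu> x
          \<le> (norm c * norm (T k x) + norm d * norm (T l x)) * \<nu> x"
        using \<nu>[of x] kl lcHs_scale[OF X(2)] T_add[of "?s c k" "?s d l"] T_scale
        by (auto simp: norm_mult[symmetric] norm_triangle_ineq intro!: mult_right_mono)
      also have "\<dots> = norm c * (norm (T k x) * \<nu> x) + norm d * (norm (T l x) * \<nu> x)"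
        by (simp add: algebra_simps)
      also have "\<dots> \<le> norm c * 1 + norm d * 1"
        using k l by (intro add_mono mult_left_mono) (auto simp: B)
      finally show ?thesis using cd by simp
    qed
    then show "?s c k + ?s d l \<in> ?B"
      using lcHs_combination[OF X(2) kl] by (simp add: B)
  qed
  have "\<forall>\<iota>\<in>I. \<exists>u\<in>eps_maps ?s X sE. f \<iota> = S_map X u"
    using f_mem by (auto simp: F_eps_nu_def)
  then obtain u where u: "\<And>\<iota>. \<iota> \<in> I \<Longrightarrow> u \<iota> \<in> eps_maps ?s X sE" "\<And>\<iota>. \<iota> \<in> I \<Longrightarrow> f \<iota> = S_map X (u \<iota>)"
    by metis
  obtain \<iota>0 where \<iota>0: "\<iota>0 \<in> I" using net by (auto simp: directed_on_def)
  \<comment> \<open>Consistency speaks about a given member of the epsilon-product; any index of the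
    nonempty net supplies one.\<close>
  have T_dual: "?T x \<in> dual ?s X" for x
    using consistent u(1)[OF \<iota>0] by (simp add: consistent_def)
  have TE_eq: "TE (f \<iota>) x = u \<iota> (?T x)" if "\<iota> \<in> I" for \<iota> x
    using consistent u[OF that] by (simp add: consistent_def)
  obtain C where C: "\<And>\<iota> x. \<iota> \<in> I \<Longrightarrow> norm (TE (f \<iota>) x) * \<nu> x \<le> C"
  proof -
    obtain C where C: "\<And>\<iota>. \<iota> \<in> I \<Longrightarrow> f \<iota> \<in> Fnu \<nu> TE XE" "\<And>\<iota>. \<iota> \<in> I \<Longrightarrow> nu_norm \<nu> TE (f \<iota>) \<le> C"
      using f_bounded by blast
    have "norm (TE (f \<iota>) x) * \<nu> x \<le> nu_norm \<nu> TE (f \<iota>)" if "\<iota> \<in> I" for \<iota> x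
      unfolding nu_norm_def by (rule cSUP_upper) (use C(1)[OF that] in \<open>auto simp: Fnu_def\<close>)
    with C(2) show ?thesis by (meson order_trans that)
  qed
  have C0: "C \<ge> 0"
    using C[OF \<iota>0] \<nu> by (meson less_imp_le mult_nonneg_nonneg norm_ge_zero order_trans)
  \<comment> \<open>The weighted point functionals. The points where all of them are at most
    \<open>1\<close> in modulus form exactly the unit ball, so the polar of the ball is their
    bipolar.\<close>
  define g where "g x = fscale times (of_real (\<nu> x)) (?T x)" for x
  have g_dual: "g x \<in> dual ?s X" for x
    unfolding g_def by (intro dual_fscale T_dual)
  have bound: "norm (u \<iota> y) \<le> C" if \<iota>: "\<iota> \<in> I" and y: "y \<in> polar_in_dual ?s X ?B" for \<iota> y
  proof (rule eps_maps_bipolar_bound[OF X(2) E(1) u(1)[OF \<iota>] _ g_dual _ C0])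
    show yd: "y \<in> dual ?s X" using y by (simp add: polar_in_dual_def)
    have lin: "linear_on (fscale times) sE (dual ?s X) (u \<iota>)" using u(1)[OF \<iota>] by (simp add: eps_maps_def)
    show "norm (u \<iota> (g x)) \<le> C" for x
      unfolding g_def norm_dual_map_fscale[OF lin E(1) T_dual]
      using C[OF \<iota>, of x] \<nu>[of x] by (simp add: TE_eq[OF \<iota>] mult.commute)
    fix k and \<epsilon> :: real assume k: "k \<in> topspace X" and \<epsilon>: "\<epsilon> > 0"
    show "norm (y k) < \<epsilon> \<or> (\<exists>x. norm (y k) < \<epsilon> + norm (g x k))"
    proof (rule ccontr)
      assume neg: "\<not> ?thesis"
      \<comment> \<open>Failure of the domination puts every \<open>norm (g x k)\<close> at least
        \<epsilon> below \<open>norm (y k)\<close>. Giving back half of \<epsilon> keeps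
        \<open>a\<close> positive and above all of them, so \<open>k\<close> divided by
        \<open>a\<close> lies in the ball; then \<open>norm (y k) \<le> a\<close>, which contradicts
        the choice of \<open>a\<close>.\<close>
      define a where "a = norm (y k) - \<epsilon> / 2"
      have a: "a > 0" using neg \<epsilon> by (simp add: a_def)
      have "norm (T k x) * \<nu> x \<le> a" for x
      proof -
        have "norm (g x k) = norm (T k x) * \<nu> x"
          using \<nu>[of x] by (simp add: g_def fscale_def norm_mult Teq[OF k])
        moreover have "\<epsilon> + norm (g x k) \<le> norm (y k)" using neg by (simp add: not_less)
        ultimately show ?thesis using \<epsilon> by (simp add: a_def)
      qed
      then have "norm (T (?s (of_real (inverse a)) k) x) * \<nu> x \<le> 1" for x
        using a unfolding T_scale[OF k] by (simp add: norm_mult norm_inverse norm_divide field_simps)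
      then have "?s (of_real (inverse a)) k \<in> ?B"
        using lcHs_scale[OF X(2) k] by (simp add: B)
      then have "norm (y (?s (of_real (inverse a)) k)) \<le> 1" using y by (simp add: polar_in_dual_def)
      then have "norm (y k) \<le> a"
        using a unfolding dual_scale_arg[OF yd k] by (simp add: norm_mult norm_inverse norm_divide field_simps)
      then show False using \<epsilon> by (simp add: a_def)
    qed
  qed
  have tails: "?\<F> \<noteq> bot" "eventually (\<lambda>\<iota>. \<iota> \<in> I) ?\<F>"
  proof -
    have "le i i" if "i \<in> I" for i using net that by (simp add: directed_on_def)
    then show "?\<F> \<noteq> bot"
      unfolding trivial_limit_def eventually_net_filter[OF net] by blast
    show "eventually (\<lambda>\<iota>. \<iota> \<in> I) ?\<F>"
      unfolding eventually_net_filter[OF net] using \<iota>0 by blast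
  qed
  \<comment> \<open>The compact set is the unit ball itself, and uniqueness on \<open>U\<close> says
    that the functionals \<open>?T x\<close> with \<open>x\<close> in \<open>U\<close> separate its
    points from \<open>0\<close>.\<close>
  obtain v where v: "v \<in> eps_maps ?s X sE" "\<And>y. y \<in> polar_in_dual ?s X ?B \<Longrightarrow> norm (v y) \<le> C"
    "limitin (eps_product ?s X sE) u v ?\<F>"
  proof (rule eps_maps_net_convergent[OF X(2) E(1) ball_compact B_acx])
    show "?T x \<in> dual ?s X" for x by (rule T_dual)
    show "k = 0" if "k \<in> ?B" "\<forall>x\<in>U. ?T x k = 0" for k
    proof -
      have k: "k \<in> Fnu \<nu> T X" "k \<in> topspace X" using that(1) by (auto simp: Fnu_ball_def Fnu_def)
      then have "\<forall>x\<in>U. T k x = 0" using that(2) by (simp add: Teq)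
      with U k(1) show ?thesis unfolding set_of_uniqueness_def by blast
    qed
    show "?\<F> \<noteq> bot" by (rule tails)
    show "eventually (\<lambda>\<iota>. u \<iota> \<in> eps_maps ?s X sE \<and> (\<forall>y\<in>polar_in_dual ?s X ?B. norm (u \<iota> y) \<le> C)) ?\<F>"
      by (rule eventually_mono[OF tails(2)]) (simp add: u(1) bound)
    show "\<exists>l. ((\<lambda>\<iota>. u \<iota> (?T x)) \<longlongrightarrow> l) ?\<F>" if x: "x \<in> U" for x
    proof -
      obtain l where "((\<lambda>\<iota>. TE (f \<iota>) x) \<longlongrightarrow> l) ?\<F>" using f_lim[OF x] by blast
      then have "((\<lambda>\<iota>. u \<iota> (?T x)) \<longlongrightarrow> l) ?\<F>"
        by (rule Lim_transform_eventually) (rule eventually_mono[OF tails(2)], rule TE_eq)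
      then show ?thesis by blast
    qed
  qed (rule that)
  have "S_map X v \<in> F_eps_nu \<nu> T X sE"
    using v(1,2) unfolding F_eps_nu_def by (auto intro!: imageI boundedI)
  \<comment> \<open>Of the embedding property only continuity into \<open>XE\<close> enters; it
    carries the limit in the epsilon-product to the limit of the functions.\<close>
  moreover have "continuous_map (eps_product ?s X sE) XE (S_map X)"
    using compatible unfolding eps_into_compatible_def embedding_map_def
    by (meson continuous_map_in_subtopology homeomorphic_imp_continuous_map)
  then have "limitin XE (S_map X \<circ> u) (S_map X v) ?\<F>"
    using v(3) by (rule continuous_map_limit)
  then have "limitin XE f (S_map X v) ?\<F>"
    by (rule limitin_transform_eventually[rotated])
      (rule eventually_mono[OF tails(2)], simp add: u(2))
  ultimately show ?thesis by blast
qed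

end
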